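(* Let $(M,g,J)$ be a locally conformal Kaehler manifold with Lee form $\omega$ and Lee vector field $B_1$, and let $(B,g_B)$ be a Riemannian manifold. Then there does not exist a Lagrangian Riemannian submersion $\pi$ from $M$ onto $B$ with $B_1\in\Gamma(\ker\pi_* )$ such that $M$ is a locally proper twisted product manifold of the form $M_{(\ker\pi_* )^\bot}\times_fM_{(\ker\pi_* )}$, where $M_{(\ker\pi_* )^\bot}$ and $M_{(\ker\pi_* )}$ are integral manifolds of the distributions $(\ker\pi_* )^\bot$ and $\ker\pi_*$.
   Context: Locally conformal Kaehler (l.c.K.) manifold: a Hermitian manifold $(M,J,g)$, with $\Omega(X,Y)=g(X,JY)$, for which there is a globally defined closed $1$-form $\omega$ (the Lee form) with $d\Omega=\omega\wedge\Omega$. The Lee vector field $B_1$ is defined by $g(X,B_1)=\omega(X)$. Riemannian submersion $\pi:(M,g)\to(B,g_B)$ (with $\dim M>\dim B$): a surjective smooth map of maximal rank whose differential $\pi_*$ preserves lengths of horizontal vectors. $\ker\pi_*$ is the vertical distribution, $(\ker\pi_* )^\bot$ the horizontal one. $\pi$ is Lagrangian if $J(\ker\pi_* )=(\ker\pi_* )^\bot$. Twisted product: if $g$ is a Riemannian metric on a product $N_1\times N_2$ whose canonical foliations $\mathcal D_{N_1},\mathcal D_{N_2}$ intersect perpendicularly everywhere, then $g$ is the metric of a twisted product $N_1\times_fN_2$ if and only if $\mathcal D_{N_1}$ is a totally geodesic foliation and $\mathcal D_{N_2}$ is a totally umbilical foliation; it is the metric of a usual product of Riemannian manifolds if and only if both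 foliations are totally geodesic (criterion of Ponge and Reckziegel, taken as definition). A twisted product is "proper" if it is not a usual product of Riemannian manifolds.
   Formalization: The formal theorem assumes M has real dimension at least 4; in real dimension 2 the claim fails, e.g. M = R^2 with g = dt^2 + e^{2t} ds^2, ω = 0, B_1 = 0 and π(t,s) = t. *)

theory Defs
  imports "HOL-Analysis.Analysis"
begin

section \<open>Smooth maps between open subsets of Euclidean spaces\<close>

primrec Ck_on :: "nat \<Rightarrow> 'a::euclidean_space set \<Rightarrow> ('a \<Rightarrow> 'b::real_normed_vector) \<Rightarrow> bool" where
  "Ck_on 0 S f \<longleftrightarrow> continuous_on S f"
| "Ck_on (Suc k) S f \<longleftrightarrow>
     (\<forall>x\<in>S. f differentiable (at x)) \<and> (\<forall>v. Ck_on k S (\<lambda>x. frechet_derivative f (at x) v))"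

definition smooth_on :: "'a::euclidean_space set \<Rightarrow> ('a \<Rightarrow> 'b::real_normed_vector) \<Rightarrow> bool" where
  "smooth_on S f \<longleftrightarrow> (\<forall>k. Ck_on k S f)"


section \<open>Smooth manifolds\<close>

text \<open>The underlying set of a manifold is a whole type \<open>'m\<close> (Hausdorff and second countable), and
  the manifold is modelled on a Euclidean space \<open>'e\<close>, so its dimension is \<open>DIM('e)\<close>. A chart is a
  pair of its domain and its coordinate map; the coordinate map is irrelevant outside the domain.\<close>

type_synonym ('m, 'e) chart = "'m set \<times> ('m \<Rightarrow> 'e)"

definition chart_inv :: "('m, 'e) chart \<Rightarrow> 'e \<Rightarrow> 'm" where
  "chart_inv c = inv_into (fst c) (snd c)"

definition is_chart :: "('m::topological_space, 'e::euclidean_space) chart \<Rightarrow> bool" where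
  "is_chart c \<longleftrightarrow> open (fst c) \<and> open (snd c ` fst c) \<and>
     homeomorphism (fst c) (snd c ` fst c) (snd c) (chart_inv c)"

definition transition :: "('m, 'e) chart \<Rightarrow> ('m, 'e) chart \<Rightarrow> 'e \<Rightarrow> 'e" where
  "transition c d = snd d \<circ> chart_inv c"

definition compatible ::
    "('m::topological_space, 'e::euclidean_space) chart \<Rightarrow> ('m, 'e) chart \<Rightarrow> bool" where
  "compatible c d \<longleftrightarrow> smooth_on (snd c ` (fst c \<inter> fst d)) (transition c d) \<and>
     smooth_on (snd d ` (fst c \<inter> fst d)) (transition d c)"

text \<open>A smooth structure is a maximal smooth atlas.\<close>

definition smooth_manifold ::
    "('m::{t2_space,second_countable_topology}, 'e::euclidean_space) chart set \<Rightarrow> bool" where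
  "smooth_manifold A \<longleftrightarrow> (\<Union>c\<in>A. fst c) = UNIV \<and> (\<forall>c\<in>A. is_chart c) \<and>
     (\<forall>c\<in>A. \<forall>d\<in>A. compatible c d) \<and>
     (\<forall>c. is_chart c \<and> (\<forall>d\<in>A. compatible c d) \<longrightarrow> c \<in> A)"

text \<open>The tangent space at \<open>p\<close> is the model space \<open>'e\<close>, a tangent vector being given by its
  components in one selected chart \<open>chart_at A p\<close> around \<open>p\<close>. In any other chart \<open>c\<close>
  around \<open>p\<close> its components are given by \<open>tan_to A c p\<close>, and \<open>tan_from A c p\<close> is the inverse
  transformation. The selection varies with \<open>p\<close> in an arbitrary way; smoothness of a field is
  therefore always a condition on its components in the charts of the atlas.\<close>

definition chart_at :: "('m, 'e) chart set \<Rightarrow> 'm \<Rightarrow> ('m, 'e) chart" where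
  "chart_at A p = (SOME c. c \<in> A \<and> p \<in> fst c)"

abbreviation coord_at :: "('m, 'e) chart set \<Rightarrow> 'm \<Rightarrow> 'e" where
  "coord_at A p \<equiv> snd (chart_at A p) p"

definition tan_to ::
    "('m, 'e::euclidean_space) chart set \<Rightarrow> ('m, 'e) chart \<Rightarrow> 'm \<Rightarrow> 'e \<Rightarrow> 'e" where
  "tan_to A c p = frechet_derivative (transition (chart_at A p) c) (at (coord_at A p))"

definition tan_from ::
    "('m, 'e::euclidean_space) chart set \<Rightarrow> ('m, 'e) chart \<Rightarrow> 'm \<Rightarrow> 'e \<Rightarrow> 'e" where
  "tan_from A c p = frechet_derivative (transition c (chart_at A p)) (at (snd c p))"

definition smooth_map ::
    "('m::topological_space, 'e::euclidean_space) chart set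
     \<Rightarrow> ('b::topological_space, 'f::euclidean_space) chart set \<Rightarrow> ('m \<Rightarrow> 'b) \<Rightarrow> bool" where
  "smooth_map A A' \<pi> \<longleftrightarrow> continuous_on UNIV \<pi> \<and>
     (\<forall>c\<in>A. \<forall>d\<in>A'. smooth_on (snd c ` (fst c \<inter> \<pi> -` fst d)) (snd d \<circ> \<pi> \<circ> chart_inv c))"

text \<open>The differential \<open>\<pi>\<^sub>*\<close> at \<open>p\<close>, from the tangent space at \<open>p\<close> to the one at \<open>\<pi> p\<close>.\<close>

definition differential ::
    "('m, 'e::euclidean_space) chart set \<Rightarrow> ('b, 'f::euclidean_space) chart set
     \<Rightarrow> ('m \<Rightarrow> 'b) \<Rightarrow> 'm \<Rightarrow> 'e \<Rightarrow> 'f" where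
  "differential A A' \<pi> p =
     frechet_derivative (snd (chart_at A' (\<pi> p)) \<circ> \<pi> \<circ> chart_inv (chart_at A p)) (at (coord_at A p))"


section \<open>Fields and their components in a chart\<close>

definition vfield_rep ::
    "('m, 'e::euclidean_space) chart set \<Rightarrow> ('m, 'e) chart \<Rightarrow> ('m \<Rightarrow> 'e) \<Rightarrow> 'e \<Rightarrow> 'e" where
  "vfield_rep A c X y = (let q = chart_inv c y in tan_to A c q (X q))"

definition endo_rep ::
    "('m, 'e::euclidean_space) chart set \<Rightarrow> ('m, 'e) chart \<Rightarrow> ('m \<Rightarrow> 'e \<Rightarrow> 'e) \<Rightarrow> 'e \<Rightarrow> 'e \<Rightarrow> 'e" where
  "endo_rep A c J y u = (let q = chart_inv c y in tan_to A c q (J q (tan_from A c q u)))"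

definition form1_rep ::
    "('m, 'e::euclidean_space) chart set \<Rightarrow> ('m, 'e) chart \<Rightarrow> ('m \<Rightarrow> 'e \<Rightarrow> real) \<Rightarrow> 'e \<Rightarrow> 'e \<Rightarrow> real" where
  "form1_rep A c \<omega> y u = (let q = chart_inv c y in \<omega> q (tan_from A c q u))"

definition form2_rep ::
    "('m, 'e::euclidean_space) chart set \<Rightarrow> ('m, 'e) chart \<Rightarrow> ('m \<Rightarrow> 'e \<Rightarrow> 'e \<Rightarrow> real)
     \<Rightarrow> 'e \<Rightarrow> 'e \<Rightarrow> 'e \<Rightarrow> real" where
  "form2_rep A c g y u v = (let q = chart_inv c y in g q (tan_from A c q u) (tan_from A c q v))"

definition smooth_vfield_on ::
    "('m, 'e::euclidean_space) chart set \<Rightarrow> 'm set \<Rightarrow> ('m \<Rightarrow> 'e) \<Rightarrow> bool" where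
  "smooth_vfield_on A S X \<longleftrightarrow> (\<forall>c\<in>A. smooth_on (snd c ` (fst c \<inter> S)) (vfield_rep A c X))"

definition smooth_endo ::
    "('m, 'e::euclidean_space) chart set \<Rightarrow> ('m \<Rightarrow> 'e \<Rightarrow> 'e) \<Rightarrow> bool" where
  "smooth_endo A J \<longleftrightarrow> (\<forall>p. linear (J p)) \<and>
     (\<forall>c\<in>A. \<forall>u. smooth_on (snd c ` fst c) (\<lambda>y. endo_rep A c J y u))"

definition smooth_form1 ::
    "('m, 'e::euclidean_space) chart set \<Rightarrow> ('m \<Rightarrow> 'e \<Rightarrow> real) \<Rightarrow> bool" where
  "smooth_form1 A \<omega> \<longleftrightarrow> (\<forall>p. linear (\<omega> p)) \<and>
     (\<forall>c\<in>A. \<forall>u. smooth_on (snd c ` fst c) (\<lambda>y. form1_rep A c \<omega> y u))"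

definition riemannian_manifold ::
    "('m::{t2_space,second_countable_topology}, 'e::euclidean_space) chart set
     \<Rightarrow> ('m \<Rightarrow> 'e \<Rightarrow> 'e \<Rightarrow> real) \<Rightarrow> bool" where
  "riemannian_manifold A g \<longleftrightarrow> smooth_manifold A \<and>
     (\<forall>p. bilinear (g p) \<and> (\<forall>u v. g p u v = g p v u) \<and> (\<forall>u. u \<noteq> 0 \<longrightarrow> g p u u > 0)) \<and>
     (\<forall>c\<in>A. \<forall>u v. smooth_on (snd c ` fst c) (\<lambda>y. form2_rep A c g y u v))"


section \<open>Lie bracket, exterior derivative, Levi-Civita connection\<close>

text \<open>All these operators are given at \<open>p\<close> by their usual local coordinate expressions in
  \<open>chart_at A p\<close>, the chart which identifies the tangent space at \<open>p\<close> with \<open>'e\<close>; the component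
  vectors \<open>u, v, w\<close> play the role of coordinate vector fields.\<close>

definition lie_bracket ::
    "('m, 'e::euclidean_space) chart set \<Rightarrow> ('m \<Rightarrow> 'e) \<Rightarrow> ('m \<Rightarrow> 'e) \<Rightarrow> 'm \<Rightarrow> 'e" where
  "lie_bracket A X Y p =
     frechet_derivative (vfield_rep A (chart_at A p) Y) (at (coord_at A p)) (X p) -
     frechet_derivative (vfield_rep A (chart_at A p) X) (at (coord_at A p)) (Y p)"

definition deriv_form1 ::
    "('m, 'e::euclidean_space) chart set \<Rightarrow> ('m \<Rightarrow> 'e \<Rightarrow> real) \<Rightarrow> 'm \<Rightarrow> 'e \<Rightarrow> 'e \<Rightarrow> real" where
  "deriv_form1 A \<omega> p u v =
     frechet_derivative (\<lambda>y. form1_rep A (chart_at A p) \<omega> y v) (at (coord_at A p)) u"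

definition deriv_form2 ::
    "('m, 'e::euclidean_space) chart set \<Rightarrow> ('m \<Rightarrow> 'e \<Rightarrow> 'e \<Rightarrow> real) \<Rightarrow> 'm \<Rightarrow> 'e \<Rightarrow> 'e \<Rightarrow> 'e \<Rightarrow> real" where
  "deriv_form2 A g p u v w =
     frechet_derivative (\<lambda>y. form2_rep A (chart_at A p) g y v w) (at (coord_at A p)) u"

definition ext_d1 ::
    "('m, 'e::euclidean_space) chart set \<Rightarrow> ('m \<Rightarrow> 'e \<Rightarrow> real) \<Rightarrow> 'm \<Rightarrow> 'e \<Rightarrow> 'e \<Rightarrow> real" where
  "ext_d1 A \<omega> p u v = deriv_form1 A \<omega> p u v - deriv_form1 A \<omega> p v u"

definition ext_d2 ::
    "('m, 'e::euclidean_space) chart set \<Rightarrow> ('m \<Rightarrow> 'e \<Rightarrow> 'e \<Rightarrow> real) \<Rightarrow> 'm \<Rightarrow> 'e \<Rightarrow> 'e \<Rightarrow> 'e \<Rightarrow> real" where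
  "ext_d2 A \<Omega> p u v w =
     deriv_form2 A \<Omega> p u v w + deriv_form2 A \<Omega> p v w u + deriv_form2 A \<Omega> p w u v"

text \<open>Same normalisation as \<open>ext_d2\<close>: a convention with a factor \<open>1/3\<close> has it on both sides of
  \<open>d\<Omega> = \<omega> \<and> \<Omega>\<close>.\<close>

definition wedge12 ::
    "('m \<Rightarrow> 'e \<Rightarrow> real) \<Rightarrow> ('m \<Rightarrow> 'e \<Rightarrow> 'e \<Rightarrow> real) \<Rightarrow> 'm \<Rightarrow> 'e \<Rightarrow> 'e \<Rightarrow> 'e \<Rightarrow> real" where
  "wedge12 \<omega> \<Omega> p u v w = \<omega> p u * \<Omega> p v w + \<omega> p v * \<Omega> p w u + \<omega> p w * \<Omega> p u v"

text \<open>Christoffel symbols, as the bilinear map determined by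
  \<open>g(\<Gamma>(u,v), w) = (\<partial>\<^sub>u g(v,w) + \<partial>\<^sub>v g(u,w) - \<partial>\<^sub>w g(u,v)) / 2\<close>.\<close>

definition christoffel ::
    "('m, 'e::euclidean_space) chart set \<Rightarrow> ('m \<Rightarrow> 'e \<Rightarrow> 'e \<Rightarrow> real) \<Rightarrow> 'm \<Rightarrow> 'e \<Rightarrow> 'e \<Rightarrow> 'e" where
  "christoffel A g p u v = (THE z. \<forall>w. g p z w =
     (deriv_form2 A g p u v w + deriv_form2 A g p v u w - deriv_form2 A g p w u v) / 2)"

text \<open>The Levi-Civita covariant derivative of \<open>Y\<close> along \<open>X\<close> at \<open>p\<close>.\<close>

definition nabla ::
    "('m, 'e::euclidean_space) chart set \<Rightarrow> ('m \<Rightarrow> 'e \<Rightarrow> 'e \<Rightarrow> real)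
     \<Rightarrow> ('m \<Rightarrow> 'e) \<Rightarrow> ('m \<Rightarrow> 'e) \<Rightarrow> 'm \<Rightarrow> 'e" where
  "nabla A g X Y p =
     frechet_derivative (vfield_rep A (chart_at A p) Y) (at (coord_at A p)) (X p) +
     christoffel A g p (X p) (Y p)"


section \<open>Hermitian and locally conformal Kaehler manifolds\<close>

definition nijenhuis ::
    "('m, 'e::euclidean_space) chart set \<Rightarrow> ('m \<Rightarrow> 'e \<Rightarrow> 'e) \<Rightarrow> ('m \<Rightarrow> 'e) \<Rightarrow> ('m \<Rightarrow> 'e) \<Rightarrow> 'm \<Rightarrow> 'e" where
  "nijenhuis A J X Y p =
     lie_bracket A (\<lambda>q. J q (X q)) (\<lambda>q. J q (Y q)) p
     - J p (lie_bracket A (\<lambda>q. J q (X q)) Y p)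
     - J p (lie_bracket A X (\<lambda>q. J q (Y q)) p)
     - lie_bracket A X Y p"

definition hermitian_manifold ::
    "('m::{t2_space,second_countable_topology}, 'e::euclidean_space) chart set
     \<Rightarrow> ('m \<Rightarrow> 'e \<Rightarrow> 'e \<Rightarrow> real) \<Rightarrow> ('m \<Rightarrow> 'e \<Rightarrow> 'e) \<Rightarrow> bool" where
  "hermitian_manifold A g J \<longleftrightarrow> riemannian_manifold A g \<and> smooth_endo A J \<and>
     (\<forall>p u. J p (J p u) = - u) \<and>
     (\<forall>p u v. g p (J p u) (J p v) = g p u v) \<and>
     (\<forall>S X Y. open S \<and> smooth_vfield_on A S X \<and> smooth_vfield_on A S Y \<longrightarrow>
        (\<forall>p\<in>S. nijenhuis A J X Y p = 0))"

definition fundamental_form ::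
    "('m \<Rightarrow> 'e \<Rightarrow> 'e \<Rightarrow> real) \<Rightarrow> ('m \<Rightarrow> 'e \<Rightarrow> 'e) \<Rightarrow> 'm \<Rightarrow> 'e \<Rightarrow> 'e \<Rightarrow> real" where
  "fundamental_form g J p u v = g p u (J p v)"

text \<open>\<open>\<omega>\<close> is the Lee form. It is determined by \<open>g\<close> and \<open>J\<close> if \<open>DIM('e) \<ge> 4\<close>; on a surface the
  condition \<open>d\<Omega> = \<omega> \<and> \<Omega>\<close> is void.\<close>

definition lck_manifold ::
    "('m::{t2_space,second_countable_topology}, 'e::euclidean_space) chart set
     \<Rightarrow> ('m \<Rightarrow> 'e \<Rightarrow> 'e \<Rightarrow> real) \<Rightarrow> ('m \<Rightarrow> 'e \<Rightarrow> 'e) \<Rightarrow> ('m \<Rightarrow> 'e \<Rightarrow> real) \<Rightarrow> bool" where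
  "lck_manifold A g J \<omega> \<longleftrightarrow> hermitian_manifold A g J \<and> smooth_form1 A \<omega> \<and>
     (\<forall>p u v. ext_d1 A \<omega> p u v = 0) \<and>
     (\<forall>p u v w. ext_d2 A (fundamental_form g J) p u v w = wedge12 \<omega> (fundamental_form g J) p u v w)"

definition is_lee_vfield ::
    "('m \<Rightarrow> 'e \<Rightarrow> 'e \<Rightarrow> real) \<Rightarrow> ('m \<Rightarrow> 'e \<Rightarrow> real) \<Rightarrow> ('m \<Rightarrow> 'e) \<Rightarrow> bool" where
  "is_lee_vfield g \<omega> B\<^sub>1 \<longleftrightarrow> (\<forall>p x. g p x (B\<^sub>1 p) = \<omega> p x)"


section \<open>Lagrangian Riemannian submersions\<close>

definition vertical ::
    "('m, 'e::euclidean_space) chart set \<Rightarrow> ('b, 'f::euclidean_space) chart set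
     \<Rightarrow> ('m \<Rightarrow> 'b) \<Rightarrow> 'm \<Rightarrow> 'e set" where
  "vertical A A' \<pi> p = {v. differential A A' \<pi> p v = 0}"

definition orth_distr :: "('m \<Rightarrow> 'e \<Rightarrow> 'e \<Rightarrow> real) \<Rightarrow> ('m \<Rightarrow> 'e set) \<Rightarrow> 'm \<Rightarrow> 'e set" where
  "orth_distr g D p = {u. \<forall>v\<in>D p. g p u v = 0}"

abbreviation horizontal ::
    "('m, 'e::euclidean_space) chart set \<Rightarrow> ('m \<Rightarrow> 'e \<Rightarrow> 'e \<Rightarrow> real)
     \<Rightarrow> ('b, 'f::euclidean_space) chart set \<Rightarrow> ('m \<Rightarrow> 'b) \<Rightarrow> 'm \<Rightarrow> 'e set" where
  "horizontal A g A' \<pi> \<equiv> orth_distr g (vertical A A' \<pi>)"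

definition riemannian_submersion ::
    "('m::topological_space, 'e::euclidean_space) chart set \<Rightarrow> ('m \<Rightarrow> 'e \<Rightarrow> 'e \<Rightarrow> real)
     \<Rightarrow> ('b::topological_space, 'f::euclidean_space) chart set \<Rightarrow> ('b \<Rightarrow> 'f \<Rightarrow> 'f \<Rightarrow> real)
     \<Rightarrow> ('m \<Rightarrow> 'b) \<Rightarrow> bool" where
  "riemannian_submersion A g A' g' \<pi> \<longleftrightarrow> DIM('e) > DIM('f) \<and> smooth_map A A' \<pi> \<and> surj \<pi> \<and>
     (\<forall>p. surj (differential A A' \<pi> p)) \<and>
     (\<forall>p. \<forall>u\<in>horizontal A g A' \<pi> p.
        g' (\<pi> p) (differential A A' \<pi> p u) (differential A A' \<pi> p u) = g p u u)"

definition lagrangian_riemannian_submersion ::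
    "('m::topological_space, 'e::euclidean_space) chart set \<Rightarrow> ('m \<Rightarrow> 'e \<Rightarrow> 'e \<Rightarrow> real)
     \<Rightarrow> ('m \<Rightarrow> 'e \<Rightarrow> 'e)
     \<Rightarrow> ('b::topological_space, 'f::euclidean_space) chart set \<Rightarrow> ('b \<Rightarrow> 'f \<Rightarrow> 'f \<Rightarrow> real)
     \<Rightarrow> ('m \<Rightarrow> 'b) \<Rightarrow> bool" where
  "lagrangian_riemannian_submersion A g J A' g' \<pi> \<longleftrightarrow> riemannian_submersion A g A' g' \<pi> \<and>
     (\<forall>p. J p ` vertical A A' \<pi> p = horizontal A g A' \<pi> p)"


section \<open>Twisted products\<close>

text \<open>\<open>X \<in> \<Gamma>(D)\<close> over the open set \<open>S\<close>.\<close>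

definition section_on ::
    "('m, 'e::euclidean_space) chart set \<Rightarrow> ('m \<Rightarrow> 'e set) \<Rightarrow> 'm set \<Rightarrow> ('m \<Rightarrow> 'e) \<Rightarrow> bool" where
  "section_on A D S X \<longleftrightarrow> smooth_vfield_on A S X \<and> (\<forall>p\<in>S. X p \<in> D p)"

text \<open>In the next two definitions \<open>D\<close> is (over \<open>S\<close>) the tangent distribution of a foliation; the
  component of \<open>nabla A g V W\<close> orthogonal to \<open>D\<close> is then the second fundamental form of its
  leaves, and \<open>h\<close> is their mean curvature vector at \<open>p\<close>.\<close>

definition totally_geodesic_on ::
    "('m::topological_space, 'e::euclidean_space) chart set \<Rightarrow> ('m \<Rightarrow> 'e \<Rightarrow> 'e \<Rightarrow> real)
     \<Rightarrow> ('m \<Rightarrow> 'e set) \<Rightarrow> 'm set \<Rightarrow> bool" where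
  "totally_geodesic_on A g D S \<longleftrightarrow>
     (\<forall>T V W. open T \<and> T \<subseteq> S \<and> section_on A D T V \<and> section_on A D T W \<longrightarrow>
        (\<forall>p\<in>T. nabla A g V W p \<in> D p))"

definition totally_umbilical_on ::
    "('m::topological_space, 'e::euclidean_space) chart set \<Rightarrow> ('m \<Rightarrow> 'e \<Rightarrow> 'e \<Rightarrow> real)
     \<Rightarrow> ('m \<Rightarrow> 'e set) \<Rightarrow> 'm set \<Rightarrow> bool" where
  "totally_umbilical_on A g D S \<longleftrightarrow>
     (\<forall>p\<in>S. \<exists>h\<in>orth_distr g D p.
        \<forall>T V W. open T \<and> p \<in> T \<and> T \<subseteq> S \<and> section_on A D T V \<and> section_on A D T W \<longrightarrow>
          nabla A g V W p - g p (V p) (W p) *\<^sub>R h \<in> D p)"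

text \<open>The chart \<open>c\<close> identifies its domain with a product \<open>P \<times> Q\<close> of open subsets of two
  complementary subspaces (written as an internal direct sum), so that \<open>D\<^sub>1\<close> and \<open>D\<^sub>2\<close> are the
  tangent distributions of the canonical foliations by the slices \<open>P \<times> {b}\<close> and \<open>{a} \<times> Q\<close>; these
  slices are integral manifolds of \<open>D\<^sub>1\<close> and \<open>D\<^sub>2\<close>.\<close>

definition product_chart ::
    "('m, 'e::euclidean_space) chart set \<Rightarrow> ('m \<Rightarrow> 'e set) \<Rightarrow> ('m \<Rightarrow> 'e set) \<Rightarrow> ('m, 'e) chart \<Rightarrow> bool" where
  "product_chart A D\<^sub>1 D\<^sub>2 c \<longleftrightarrow> c \<in> A \<and>
     (\<exists>E\<^sub>1 E\<^sub>2 P Q. subspace E\<^sub>1 \<and> subspace E\<^sub>2 \<and> E\<^sub>1 \<inter> E\<^sub>2 = {0} \<and>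
        {a + b |a b. a \<in> E\<^sub>1 \<and> b \<in> E\<^sub>2} = UNIV \<and>
        P \<subseteq> E\<^sub>1 \<and> Q \<subseteq> E\<^sub>2 \<and> snd c ` fst c = {a + b |a b. a \<in> P \<and> b \<in> Q} \<and>
        (\<forall>q\<in>fst c. D\<^sub>1 q = {v. tan_to A c q v \<in> E\<^sub>1} \<and> D\<^sub>2 q = {v. tan_to A c q v \<in> E\<^sub>2}))"

definition perpendicular_on ::
    "('m \<Rightarrow> 'e \<Rightarrow> 'e \<Rightarrow> real) \<Rightarrow> ('m \<Rightarrow> 'e set) \<Rightarrow> ('m \<Rightarrow> 'e set) \<Rightarrow> 'm set \<Rightarrow> bool" where
  "perpendicular_on g D\<^sub>1 D\<^sub>2 S \<longleftrightarrow> (\<forall>p\<in>S. \<forall>u\<in>D\<^sub>1 p. \<forall>v\<in>D\<^sub>2 p. g p u v = 0)"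

text \<open>Locally \<open>M\<close> is a twisted product \<open>M\<^sub>1 \<times>\<^sub>f M\<^sub>2\<close>, respectively a usual product
  \<open>M\<^sub>1 \<times> M\<^sub>2\<close> of Riemannian manifolds, with \<open>M\<^sub>1\<close>, \<open>M\<^sub>2\<close> integral manifolds of \<open>D\<^sub>1\<close>, \<open>D\<^sub>2\<close>
  (criterion of Ponge and Reckziegel).\<close>

definition locally_twisted_product ::
    "('m::topological_space, 'e::euclidean_space) chart set \<Rightarrow> ('m \<Rightarrow> 'e \<Rightarrow> 'e \<Rightarrow> real)
     \<Rightarrow> ('m \<Rightarrow> 'e set) \<Rightarrow> ('m \<Rightarrow> 'e set) \<Rightarrow> bool" where
  "locally_twisted_product A g D\<^sub>1 D\<^sub>2 \<longleftrightarrow>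
     (\<forall>p. \<exists>c. p \<in> fst c \<and> product_chart A D\<^sub>1 D\<^sub>2 c \<and> perpendicular_on g D\<^sub>1 D\<^sub>2 (fst c) \<and>
        totally_geodesic_on A g D\<^sub>1 (fst c) \<and> totally_umbilical_on A g D\<^sub>2 (fst c))"

definition locally_riemannian_product ::
    "('m::topological_space, 'e::euclidean_space) chart set \<Rightarrow> ('m \<Rightarrow> 'e \<Rightarrow> 'e \<Rightarrow> real)
     \<Rightarrow> ('m \<Rightarrow> 'e set) \<Rightarrow> ('m \<Rightarrow> 'e set) \<Rightarrow> bool" where
  "locally_riemannian_product A g D\<^sub>1 D\<^sub>2 \<longleftrightarrow>
     (\<forall>p. \<exists>c. p \<in> fst c \<and> product_chart A D\<^sub>1 D\<^sub>2 c \<and> perpendicular_on g D\<^sub>1 D\<^sub>2 (fst c) \<and>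
        totally_geodesic_on A g D\<^sub>1 (fst c) \<and> totally_geodesic_on A g D\<^sub>2 (fst c))"

definition locally_proper_twisted_product ::
    "('m::topological_space, 'e::euclidean_space) chart set \<Rightarrow> ('m \<Rightarrow> 'e \<Rightarrow> 'e \<Rightarrow> real)
     \<Rightarrow> ('m \<Rightarrow> 'e set) \<Rightarrow> ('m \<Rightarrow> 'e set) \<Rightarrow> bool" where
  "locally_proper_twisted_product A g D\<^sub>1 D\<^sub>2 \<longleftrightarrow>
     locally_twisted_product A g D\<^sub>1 D\<^sub>2 \<and> \<not> locally_riemannian_product A g D\<^sub>1 D\<^sub>2"

end

theory Submission
  imports Defs
begin

text \<open>The vertical and the horizontal distribution of a Lagrangian submersion are exchanged by \<open>J\<close>,
  so the fibres are Lagrangian: \<open>\<Omega>\<close> vanishes on vertical vectors, and on horizontal ones. In a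
  Kaehler manifold the second fundamental form of a Lagrangian foliation is known to be symmetric
  in the sense that \<open>g(\<nabla>\<^sub>V W, J U)\<close> is symmetric in \<open>V\<close>, \<open>W\<close>, \<open>U\<close>. The obstruction to this
  symmetry in a Hermitian manifold is \<open>g((\<nabla>\<^sub>V J) U, W)\<close>, and integrability of \<open>J\<close> gives
  \<open>2 g((\<nabla>\<^sub>X J) Y, Z) = d\<Omega>(X, J Y, J Z) - d\<Omega>(X, Y, Z)\<close> (lemma \<open>g_nabla_endo\<close>). When
  \<open>d\<Omega> = \<omega> \<and> \<Omega>\<close>, the right-hand side is zero on vertical vectors as soon as \<open>\<omega>\<close> is zero on
  horizontal ones, that is, as soon as the Lee vector field is vertical. So the symmetry
  survives (lemma \<open>isotropic_second_fundamental_form_sym\<close>).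

  If the fibres are moreover totally umbilical with mean curvature vector \<open>h\<close>, the symmetric form is
  \<open>g(V, W) g(h, J U)\<close>. Let \<open>h = J U\<close> and let \<open>V = W\<close> be a nonzero vertical vector orthogonal to
  \<open>U\<close>, which exists because the fibres have dimension at least two. Exchanging \<open>W\<close> and \<open>U\<close> gives
  \<open>g(V, V) g(h, h) = 0\<close>, hence \<open>h = 0\<close> (lemma \<open>symmetric_umbilical_form_eq_0\<close>). The fibres are
  therefore totally geodesic, and every local twisted product structure is a Riemannian product.

  The computations at a point \<open>p\<close> take place in the chart selected at \<open>p\<close>. The fields \<open>V\<close>, \<open>W\<close>, \<open>U\<close>
  through given vertical vectors are those with constant components in a product chart; that such a
  field is smooth in all charts of the atlas rests on the chain rule for maps of class
  \<open>C\<^sup>k\<close> (lemma \<open>Ck_on_compose\<close>).\<close>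


section \<open>Smooth maps on open sets\<close>

lemma frechet_derivative_cong_open:
  assumes "open S" "x \<in> S" "\<And>y. y \<in> S \<Longrightarrow> f y = g y"
  shows "frechet_derivative f (at x) = frechet_derivative g (at x)"
proof -
  have "(f has_derivative f') (at x) \<longleftrightarrow> (g has_derivative f') (at x)" for f'
    using has_derivative_transform_within_open[OF _ assms(1,2)] assms(3) by metis
  then show ?thesis
    by (simp add: frechet_derivative_def)
qed

lemma differentiable_cong_open:
  assumes "open S" "x \<in> S" "\<And>y. y \<in> S \<Longrightarrow> f y = g y" "f differentiable (at x)"
  shows "g differentiable (at x)"
  using assms has_derivative_transform_within_open unfolding differentiable_def by metis

lemma Ck_on_cong:
  assumes "open S" "\<And>y. y \<in> S \<Longrightarrow> f y = g y" "Ck_on k S f"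
  shows "Ck_on k S g"
  using assms(2,3)
proof (induction k arbitrary: f g)
  case 0
  then show ?case
    by (simp cong: continuous_on_cong)
next
  case (Suc k)
  have "Ck_on k S (\<lambda>x. frechet_derivative g (at x) v)" for v
  proof (rule Suc.IH)
    show "frechet_derivative f (at y) v = frechet_derivative g (at y) v" if "y \<in> S" for y
      using frechet_derivative_cong_open[OF assms(1) that Suc.prems(1)] by simp
  qed (use Suc.prems in simp)
  with Suc.prems differentiable_cong_open[OF assms(1), of _ f g] show ?case
    by auto
qed

lemma Ck_on_Suc_imp: "Ck_on (Suc k) S f \<Longrightarrow> Ck_on k S f"
proof (induction k arbitrary: f)
  case 0
  then show ?case
    by (simp add: differentiable_imp_continuous_on differentiable_at_imp_differentiable_on)
next
  case (Suc k)
  then show ?case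
    by (metis Ck_on.simps(2))
qed

lemma Ck_on_const: "Ck_on k S (\<lambda>x. c)"
  by (induction k arbitrary: c) auto

lemma Ck_on_compose_linear:
  assumes "open S" "bounded_linear L" "Ck_on k S f"
  shows "Ck_on k S (\<lambda>x. L (f x))"
  using assms(3)
proof (induction k arbitrary: f)
  case 0
  then show ?case
    using bounded_linear.continuous_on[OF assms(2)] by auto
next
  case (Suc k)
  have der: "((\<lambda>x. L (f x)) has_derivative (\<lambda>v. L (frechet_derivative f (at x) v))) (at x)"
    if "x \<in> S" for x
    using Suc.prems that
    by (intro bounded_linear.has_derivative[OF assms(2)]) (auto simp: frechet_derivative_works)
  have "Ck_on k S (\<lambda>x. L (frechet_derivative f (at x) v))" for v
    using Suc.prems by (intro Suc.IH) auto
  then have "Ck_on k S (\<lambda>x. frechet_derivative (\<lambda>x. L (f x)) (at x) v)" for v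
    by (rule Ck_on_cong[OF assms(1), rotated]) (simp add: frechet_derivative_at[symmetric, OF der])
  then show ?case
    using der by (auto simp: differentiable_def)
qed

lemma Ck_on_add:
  assumes "open S" "Ck_on k S f" "Ck_on k S g"
  shows "Ck_on k S (\<lambda>x. f x + g x)"
  using assms(2,3)
proof (induction k arbitrary: f g)
  case 0
  then show ?case
    by (auto intro: continuous_on_add)
next
  case (Suc k)
  have der: "((\<lambda>x. f x + g x) has_derivative
      (\<lambda>v. frechet_derivative f (at x) v + frechet_derivative g (at x) v)) (at x)"
    if "x \<in> S" for x
    using Suc.prems that by (intro has_derivative_add) (auto simp: frechet_derivative_works)
  have "Ck_on k S (\<lambda>x. frechet_derivative f (at x) v + frechet_derivative g (at x) v)" for v
    using Suc.prems by (intro Suc.IH) auto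
  then have "Ck_on k S (\<lambda>x. frechet_derivative (\<lambda>x. f x + g x) (at x) v)" for v
    by (rule Ck_on_cong[OF assms(1), rotated]) (simp add: frechet_derivative_at[symmetric, OF der])
  then show ?case
    using der by (auto simp: differentiable_def)
qed

lemma Ck_on_sum:
  assumes "open S" "finite I" "\<And>i. i \<in> I \<Longrightarrow> Ck_on k S (f i)"
  shows "Ck_on k S (\<lambda>x. \<Sum>i\<in>I. f i x)"
  using assms(2,3)
  by (induction I rule: finite_induct) (auto intro!: Ck_on_const Ck_on_add[OF assms(1)])

lemma Ck_on_scaleR:
  assumes "open S" "Ck_on k S f" "Ck_on k S g"
  shows "Ck_on k S (\<lambda>x. f x *\<^sub>R g x)"
  using assms(2,3)
proof (induction k arbitrary: f g)
  case 0
  then show ?case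
    by (auto intro: continuous_on_scaleR)
next
  case (Suc k)
  have der: "((\<lambda>x. f x *\<^sub>R g x) has_derivative
      (\<lambda>v. f x *\<^sub>R frechet_derivative g (at x) v + frechet_derivative f (at x) v *\<^sub>R g x)) (at x)"
    if "x \<in> S" for x
    using Suc.prems that by (intro has_derivative_scaleR) (auto simp: frechet_derivative_works)
  have "Ck_on k S (\<lambda>x. f x *\<^sub>R frechet_derivative g (at x) v + frechet_derivative f (at x) v *\<^sub>R g x)"
    for v
    using Suc.prems Ck_on_Suc_imp[OF Suc.prems(1)] Ck_on_Suc_imp[OF Suc.prems(2)]
    by (intro Ck_on_add[OF assms(1)] Suc.IH) auto
  then have "Ck_on k S (\<lambda>x. frechet_derivative (\<lambda>x. f x *\<^sub>R g x) (at x) v)" for v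
    by (rule Ck_on_cong[OF assms(1), rotated]) (simp add: frechet_derivative_at[symmetric, OF der])
  then show ?case
    using der by (auto simp: differentiable_def)
qed

text \<open>The derivative \<open>Df (g x) (Dg x v)\<close> of a composition is a fixed linear map applied to a vector
  that moves with \<open>x\<close>; expanding this vector in the basis leaves only products of functions to which
  the induction hypothesis applies.\<close>

lemma Ck_on_compose:
  fixes f :: "'b::euclidean_space \<Rightarrow> 'c::real_normed_vector"
  assumes "open S" "open T" "g ` S \<subseteq> T" "Ck_on k S g" "Ck_on k T f"
  shows "Ck_on k S (\<lambda>x. f (g x))"
  using assms(4,5)
proof (induction k arbitrary: f)
  case 0
  then show ?case
    using assms(3) by (auto intro: continuous_on_compose2)
next
  case (Suc k)
  have T: "g x \<in> T" if "x \<in> S" for x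
    using that assms(3) by auto
  have dg: "(g has_derivative frechet_derivative g (at x)) (at x)" if "x \<in> S" for x
    using Suc.prems(1) that by (auto simp: frechet_derivative_works)
  have df: "(f has_derivative frechet_derivative f (at (g x))) (at (g x))" if "x \<in> S" for x
    using Suc.prems(2) T[OF that] by (auto simp: frechet_derivative_works)
  have der: "((\<lambda>x. f (g x)) has_derivative
      (\<lambda>v. frechet_derivative f (at (g x)) (frechet_derivative g (at x) v))) (at x)" if "x \<in> S" for x
    by (rule has_derivative_compose[OF dg[OF that] df[OF that]])
  have expand: "frechet_derivative (\<lambda>x. f (g x)) (at x) v =
      (\<Sum>i\<in>Basis. (frechet_derivative g (at x) v \<bullet> i) *\<^sub>R frechet_derivative f (at (g x)) i)"
    if "x \<in> S" for x v
  proof -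
    interpret L: linear "frechet_derivative f (at (g x))"
      using df[OF that] has_derivative_linear by blast
    have "frechet_derivative f (at (g x)) (frechet_derivative g (at x) v) =
        frechet_derivative f (at (g x)) (\<Sum>i\<in>Basis. (frechet_derivative g (at x) v \<bullet> i) *\<^sub>R i)"
      by (simp add: euclidean_representation)
    then show ?thesis
      by (simp add: frechet_derivative_at[symmetric, OF der[OF that]] L.sum L.scaleR)
  qed
  have "Ck_on k S (\<lambda>x. frechet_derivative (\<lambda>x. f (g x)) (at x) v)" for v
  proof (rule Ck_on_cong[OF assms(1)])
    show "Ck_on k S (\<lambda>x. \<Sum>i\<in>Basis.
        (frechet_derivative g (at x) v \<bullet> i) *\<^sub>R frechet_derivative f (at (g x)) i)"
      using Suc.prems Ck_on_Suc_imp[OF Suc.prems(1)]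
      by (intro Ck_on_sum[OF assms(1)] Ck_on_scaleR[OF assms(1)] Suc.IH
          Ck_on_compose_linear[OF assms(1) bounded_linear_inner_left]) auto
  qed (simp add: expand)
  then show ?case
    using der by (auto simp: differentiable_def)
qed

lemma smooth_on_cong:
  assumes "open S" "\<And>y. y \<in> S \<Longrightarrow> f y = g y" "smooth_on S f"
  shows "smooth_on S g"
  using Ck_on_cong[where f = f and g = g, OF assms(1,2)] assms(3) by (simp add: smooth_on_def)

lemma smooth_on_compose:
  assumes "open S" "open T" "g ` S \<subseteq> T" "smooth_on S g" "smooth_on T f"
  shows "smooth_on S (\<lambda>x. f (g x))"
  using assms(4,5) Ck_on_compose[OF assms(1-3)] unfolding smooth_on_def by metis

lemma smooth_on_frechet_derivative:
  "smooth_on S f \<Longrightarrow> smooth_on S (\<lambda>x. frechet_derivative f (at x) v)"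
  unfolding smooth_on_def by (metis Ck_on.simps(2))

lemma smooth_on_imp_differentiable:
  "smooth_on S f \<Longrightarrow> x \<in> S \<Longrightarrow> f differentiable (at x)"
  unfolding smooth_on_def by (metis Ck_on.simps(2))


section \<open>Differentiating families of linear maps\<close>

text \<open>Product rule for \<open>y \<mapsto> L y (a y)\<close>. Only the functions \<open>y \<mapsto> L y u\<close> for fixed \<open>u\<close> are known
  to be differentiable; linearity reduces the moving argument to finitely many of them.\<close>

lemma has_derivative_linear_family:
  fixes L :: "'a::real_normed_vector \<Rightarrow> 'e::euclidean_space \<Rightarrow> 'c::real_normed_vector"
  assumes "open S" "x \<in> S" and lin: "\<And>y. y \<in> S \<Longrightarrow> linear (L y)"
    and diff: "\<And>u. (\<lambda>y. L y u) differentiable (at x)"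
    and a: "(a has_derivative a') (at x)"
  shows "((\<lambda>y. L y (a y)) has_derivative
           (\<lambda>v. frechet_derivative (\<lambda>y. L y (a x)) (at x) v + L x (a' v))) (at x)"
proof -
  have rep: "L y u = (\<Sum>i\<in>Basis. (u \<bullet> i) *\<^sub>R L y i)" if "y \<in> S" for y u
  proof -
    interpret linear "L y" by (rule lin[OF that])
    have "L y u = L y (\<Sum>i\<in>Basis. (u \<bullet> i) *\<^sub>R i)"
      by (simp add: euclidean_representation)
    then show ?thesis
      by (simp add: sum scaleR)
  qed
  let ?D = "\<lambda>i. frechet_derivative (\<lambda>y. L y i) (at x)"
  have D: "((\<lambda>y. L y i) has_derivative ?D i) (at x)" for i
    using diff by (simp add: frechet_derivative_works)
  have fixed: "((\<lambda>y. L y u) has_derivative (\<lambda>v. \<Sum>i\<in>Basis. (u \<bullet> i) *\<^sub>R ?D i v)) (at x)" for u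
    by (rule has_derivative_transform_within_open[OF _ assms(1,2),
          where f = "\<lambda>y. \<Sum>i\<in>Basis. (u \<bullet> i) *\<^sub>R L y i"])
       (auto intro!: derivative_eq_intros D simp: rep[symmetric])
  have "((\<lambda>y. \<Sum>i\<in>Basis. (a y \<bullet> i) *\<^sub>R L y i) has_derivative
      (\<lambda>v. \<Sum>i\<in>Basis. (a x \<bullet> i) *\<^sub>R ?D i v + (a' v \<bullet> i) *\<^sub>R L x i)) (at x)"
    by (intro has_derivative_sum has_derivative_scaleR D has_derivative_inner_left a)
  then have "((\<lambda>y. L y (a y)) has_derivative
      (\<lambda>v. \<Sum>i\<in>Basis. (a x \<bullet> i) *\<^sub>R ?D i v + (a' v \<bullet> i) *\<^sub>R L x i)) (at x)"
    by (rule has_derivative_transform_within_open[OF _ assms(1,2)]) (simp add: rep[symmetric])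
  then show ?thesis
    using assms(2)
    by (simp add: sum.distrib rep[symmetric] frechet_derivative_at[symmetric, OF fixed[of "a x"]])
qed

lemma linear_frechet_derivative_family:
  fixes L :: "'a::real_normed_vector \<Rightarrow> 'e::euclidean_space \<Rightarrow> 'c::real_normed_vector"
  assumes "open S" "x \<in> S" and lin: "\<And>y. y \<in> S \<Longrightarrow> linear (L y)"
    and diff: "\<And>u. (\<lambda>y. L y u) differentiable (at x)"
  shows "linear (\<lambda>u. frechet_derivative (\<lambda>y. L y u) (at x) v)"
proof (rule linearI)
  have D: "((\<lambda>y. L y i) has_derivative frechet_derivative (\<lambda>y. L y i) (at x)) (at x)" for i
    using diff by (simp add: frechet_derivative_works)
  show "frechet_derivative (\<lambda>y. L y (u + w)) (at x) v =
      frechet_derivative (\<lambda>y. L y u) (at x) v + frechet_derivative (\<lambda>y. L y w) (at x) v" for u w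
  proof -
    have "frechet_derivative (\<lambda>y. L y (u + w)) (at x) =
        frechet_derivative (\<lambda>y. L y u + L y w) (at x)"
      by (rule frechet_derivative_cong_open[OF assms(1,2)]) (simp add: linear_add[OF lin])
    then show ?thesis
      by (simp add: frechet_derivative_at[symmetric, OF has_derivative_add[OF D D]])
  qed
  show "frechet_derivative (\<lambda>y. L y (r *\<^sub>R u)) (at x) v =
      r *\<^sub>R frechet_derivative (\<lambda>y. L y u) (at x) v" for r u
  proof -
    have "frechet_derivative (\<lambda>y. L y (r *\<^sub>R u)) (at x) =
        frechet_derivative (\<lambda>y. r *\<^sub>R L y u) (at x)"
      by (rule frechet_derivative_cong_open[OF assms(1,2)]) (simp add: linear_scale[OF lin])
    then show ?thesis
      by (simp add: frechet_derivative_at[symmetric, OF has_derivative_scaleR_right[OF D]])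
  qed
qed

text \<open>The same for a family of bilinear forms: apply the linear rule first to \<open>y \<mapsto> G y (a y) u\<close>
  with \<open>u\<close> fixed, and then to the linear maps \<open>G y (a y)\<close>.\<close>

lemma has_derivative_bilinear_family:
  fixes G :: "'a::real_normed_vector \<Rightarrow> 'e::euclidean_space \<Rightarrow> 'e \<Rightarrow> real"
  assumes "open S" "x \<in> S" and bil: "\<And>y. y \<in> S \<Longrightarrow> bilinear (G y)"
    and diff: "\<And>u v. (\<lambda>y. G y u v) differentiable (at x)"
    and a: "(a has_derivative a') (at x)" and b: "(b has_derivative b') (at x)"
  shows "((\<lambda>y. G y (a y) (b y)) has_derivative
           (\<lambda>v. frechet_derivative (\<lambda>y. G y (a x) (b x)) (at x) v
                + G x (a' v) (b x) + G x (a x) (b' v))) (at x)"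
proof -
  have first: "((\<lambda>y. G y (a y) u) has_derivative
      (\<lambda>v. frechet_derivative (\<lambda>y. G y (a x) u) (at x) v + G x (a' v) u)) (at x)" for u
    using bil diff
    by (intro has_derivative_linear_family[OF assms(1,2), where L = "\<lambda>y z. G y z u"] a)
       (auto simp: bilinear_def)
  have diff': "(\<lambda>y. G y (a y) u) differentiable (at x)" for u
    using first differentiable_def by blast
  have "((\<lambda>y. G y (a y) (b y)) has_derivative
      (\<lambda>v. frechet_derivative (\<lambda>y. G y (a y) (b x)) (at x) v + G x (a x) (b' v))) (at x)"
    using bil diff'
    by (intro has_derivative_linear_family[OF assms(1,2), where L = "\<lambda>y. G y (a y)"] b)
       (auto simp: bilinear_def)
  then show ?thesis
    by (simp add: frechet_derivative_at[symmetric, OF first])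
qed


section \<open>Coordinate changes and components of tangent vectors\<close>

locale smooth_mfd =
  fixes A :: "('m::{t2_space,second_countable_topology}, 'e::euclidean_space) chart set"
  assumes smooth_mfd: "smooth_manifold A"
begin

lemma chart_at: "chart_at A p \<in> A" "p \<in> fst (chart_at A p)"
proof -
  have "(\<Union>c\<in>A. fst c) = UNIV"
    using smooth_mfd by (simp add: smooth_manifold_def)
  then have "\<exists>c. c \<in> A \<and> p \<in> fst c"
    by blast
  from someI_ex[OF this] show "chart_at A p \<in> A" "p \<in> fst (chart_at A p)"
    by (simp_all add: chart_at_def)
qed

lemma is_chart: "c \<in> A \<Longrightarrow> is_chart c"
  using smooth_mfd by (simp add: smooth_manifold_def)

lemma chart_homeomorphism:
  "c \<in> A \<Longrightarrow> homeomorphism (fst c) (snd c ` fst c) (snd c) (chart_inv c)"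
  using is_chart by (simp add: is_chart_def)

lemma open_chart_domain: "c \<in> A \<Longrightarrow> open (fst c)"
  using is_chart by (simp add: is_chart_def)

lemma open_chart_image:
  assumes "c \<in> A" "open S" "S \<subseteq> fst c"
  shows "open (snd c ` S)"
proof -
  have "openin (top_of_set (snd c ` fst c)) (snd c ` S)"
    using homeomorphism_imp_open_map[OF chart_homeomorphism[OF assms(1)]] assms(2,3)
    by (metis openin_open_Int inf.absorb_iff2)
  moreover have "open (snd c ` fst c)"
    using is_chart[OF assms(1)] by (simp add: is_chart_def)
  ultimately show ?thesis
    using openin_open_trans by blast
qed

lemma open_overlap_image: "c \<in> A \<Longrightarrow> open T \<Longrightarrow> open (snd c ` (fst c \<inter> T))"
  by (intro open_chart_image) (auto intro: open_chart_domain)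

lemma chart_inv_chart [simp]: "c \<in> A \<Longrightarrow> q \<in> fst c \<Longrightarrow> chart_inv c (snd c q) = q"
  using chart_homeomorphism homeomorphism_apply1 by blast

lemma transition_chart: "c \<in> A \<Longrightarrow> q \<in> fst c \<Longrightarrow> transition c d (snd c q) = snd d q"
  by (simp add: transition_def)

lemma smooth_transition:
  "c \<in> A \<Longrightarrow> d \<in> A \<Longrightarrow> smooth_on (snd c ` (fst c \<inter> fst d)) (transition c d)"
  using smooth_mfd by (simp add: smooth_manifold_def compatible_def)

lemma has_derivative_transition:
  assumes "c \<in> A" "d \<in> A" "q \<in> fst c" "q \<in> fst d"
  shows "(transition c d has_derivative frechet_derivative (transition c d) (at (snd c q)))
           (at (snd c q))"
  using smooth_on_imp_differentiable[OF smooth_transition[OF assms(1,2)], of "snd c q"] assms(3,4)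
  by (simp add: frechet_derivative_works)

lemma frechet_derivative_transition_trans:
  assumes "c \<in> A" "d \<in> A" "e \<in> A" "q \<in> fst c" "q \<in> fst d" "q \<in> fst e"
  shows "frechet_derivative (transition d e) (at (snd d q))
           (frechet_derivative (transition c d) (at (snd c q)) u)
         = frechet_derivative (transition c e) (at (snd c q)) u"
proof -
  have "((\<lambda>y. transition d e (transition c d y)) has_derivative
      (\<lambda>u. frechet_derivative (transition d e) (at (snd d q))
        (frechet_derivative (transition c d) (at (snd c q)) u))) (at (snd c q))"
    using has_derivative_transition[OF assms(2,3,5,6)] assms(1,4)
    by (intro has_derivative_compose[OF has_derivative_transition[OF assms(1,2,4,5)]])
       (simp add: transition_chart)
  then have "(transition c e has_derivative
      (\<lambda>u. frechet_derivative (transition d e) (at (snd d q))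
        (frechet_derivative (transition c d) (at (snd c q)) u))) (at (snd c q))"
  proof (rule has_derivative_transform_within_open)
    show "open (snd c ` (fst c \<inter> (fst d \<inter> fst e)))"
      using assms(1-3) by (intro open_overlap_image open_Int open_chart_domain)
  qed (use assms in \<open>auto simp: transition_chart\<close>)
  from fun_cong[OF frechet_derivative_at[OF this], of u] show ?thesis
    by simp
qed

lemma frechet_derivative_transition_self:
  assumes "c \<in> A" "q \<in> fst c"
  shows "frechet_derivative (transition c c) (at (snd c q)) u = u"
proof -
  have "((\<lambda>y. y) has_derivative (\<lambda>u. u)) (at (snd c q))"
    by (rule has_derivative_ident)
  then have "(transition c c has_derivative (\<lambda>u. u)) (at (snd c q))"
    by (rule has_derivative_transform_within_open[where s = "snd c ` fst c"])
       (use assms open_chart_image[of c "fst c"] open_chart_domain in \<open>auto simp: transition_chart\<close>)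
  from fun_cong[OF frechet_derivative_at[OF this], of u] show ?thesis
    by simp
qed

lemma tan_to_tan_from:
  assumes "c \<in> A" "d \<in> A" "q \<in> fst c" "q \<in> fst d"
  shows "tan_to A d q (tan_from A c q u) = frechet_derivative (transition c d) (at (snd c q)) u"
  unfolding tan_to_def tan_from_def
  by (rule frechet_derivative_transition_trans) (use assms chart_at in auto)

lemma tan_to_tan_from_self [simp]:
  "c \<in> A \<Longrightarrow> q \<in> fst c \<Longrightarrow> tan_to A c q (tan_from A c q u) = u"
  by (simp add: tan_to_tan_from frechet_derivative_transition_self)

lemma tan_from_tan_to_self [simp]:
  assumes "c \<in> A" "q \<in> fst c"
  shows "tan_from A c q (tan_to A c q u) = u"
proof -
  have "tan_from A c q (tan_to A c q u)
      = frechet_derivative (transition (chart_at A q) (chart_at A q)) (at (coord_at A q)) u"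
    unfolding tan_to_def tan_from_def
    by (rule frechet_derivative_transition_trans) (use assms chart_at in auto)
  then show ?thesis
    by (simp add: frechet_derivative_transition_self chart_at)
qed

lemma linear_tan_to: "c \<in> A \<Longrightarrow> q \<in> fst c \<Longrightarrow> linear (tan_to A c q)"
  unfolding tan_to_def
  using has_derivative_transition[of "chart_at A q" c q] chart_at has_derivative_linear by blast

lemma linear_tan_from: "c \<in> A \<Longrightarrow> q \<in> fst c \<Longrightarrow> linear (tan_from A c q)"
  unfolding tan_from_def
  using has_derivative_transition[of c "chart_at A q" q] chart_at has_derivative_linear by blast

lemma tan_to_chart_at [simp]: "tan_to A (chart_at A p) p u = u"
  by (simp add: tan_to_def frechet_derivative_transition_self chart_at)

lemma tan_from_chart_at [simp]: "tan_from A (chart_at A p) p u = u"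
  by (simp add: tan_from_def frechet_derivative_transition_self chart_at)

text \<open>A field with constant components in one chart has smooth components in every other chart
  \<open>d\<close>: they are a partial derivative of the transition map, read off in the coordinates of \<open>d\<close>.\<close>

lemma smooth_vfield_const_components:
  assumes "c \<in> A"
  shows "smooth_vfield_on A (fst c) (\<lambda>q. tan_from A c q u)"
  unfolding smooth_vfield_on_def
proof
  fix d assume d: "d \<in> A"
  have "smooth_on (snd d ` (fst d \<inter> fst c))
      (\<lambda>y. frechet_derivative (transition c d) (at (transition d c y)) u)"
  proof (rule smooth_on_compose[where g = "transition d c" and
        f = "\<lambda>z. frechet_derivative (transition c d) (at z) u"])
    show "smooth_on (snd c ` (fst c \<inter> fst d)) (\<lambda>z. frechet_derivative (transition c d) (at z) u)"
      by (intro smooth_on_frechet_derivative smooth_transition assms d)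
  qed (use assms d in \<open>auto intro!: open_overlap_image open_chart_domain smooth_transition
                       simp: transition_chart\<close>)
  then show "smooth_on (snd d ` (fst d \<inter> fst c)) (vfield_rep A d (\<lambda>q. tan_from A c q u))"
    by (rule smooth_on_cong[rotated 2])
       (use assms d in \<open>auto intro!: open_overlap_image open_chart_domain
          simp: vfield_rep_def Let_def transition_chart tan_to_tan_from\<close>)
qed

text \<open>Where a distribution is constant in a chart, as it is in a product chart, a field with constant
  components that is tangent to it at one point is tangent to it everywhere.\<close>

lemma section_through_vector:
  assumes "c \<in> A" "p \<in> fst c" "\<And>q. q \<in> fst c \<Longrightarrow> D q = {v. tan_to A c q v \<in> E}" "v \<in> D p"
  obtains X where "section_on A D (fst c) X" "X p = v"
proof
  let ?X = "\<lambda>q. tan_from A c q (tan_to A c p v)"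
  show "section_on A D (fst c) ?X"
    using assms by (auto simp: section_on_def smooth_vfield_const_components)
  show "?X p = v"
    using assms by simp
qed

lemma vfield_rep_has_derivative:
  assumes "smooth_vfield_on A T X" "p \<in> T"
  shows "(vfield_rep A (chart_at A p) X has_derivative
           frechet_derivative (vfield_rep A (chart_at A p) X) (at (coord_at A p)))
           (at (coord_at A p))"
proof -
  have "vfield_rep A (chart_at A p) X differentiable (at (coord_at A p))"
    using assms chart_at unfolding smooth_vfield_on_def
    by (intro smooth_on_imp_differentiable[of "snd (chart_at A p) ` (fst (chart_at A p) \<inter> T)"]) auto
  then show ?thesis
    by (simp add: frechet_derivative_works)
qed

lemma vfield_rep_chart_at [simp]: "vfield_rep A (chart_at A p) X (coord_at A p) = X p"
  by (simp add: vfield_rep_def chart_at)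

end


section \<open>The covariant derivative of the complex structure\<close>

text \<open>The formula \<open>2 g((\<nabla>\<^sub>X J) Y, Z) = d\<Omega>(X, J Y, J Z) - d\<Omega>(X, Y, Z)\<close> as an algebraic identity
  between the metric, the complex structure, their first derivatives \<open>dG x\<close> and \<open>dJ x\<close> in the
  direction \<open>x\<close>, and the Christoffel symbols, all at one point. The hypotheses \<open>dJ\<close> and \<open>dGJ\<close> are
  the derivatives of \<open>J\<^sup>2 = -1\<close> and of the compatibility of \<open>J\<close> with the metric; \<open>N\<close> is the
  vanishing of the Nijenhuis tensor on coordinate fields, and it removes those derivatives of
  \<open>J\<close> that are not taken in the direction \<open>x\<close>.\<close>

lemma hermitian_covariant_derivative_formula:
  fixes G :: "'e::real_vector \<Rightarrow> 'e \<Rightarrow> real" and dG :: "'e \<Rightarrow> 'e \<Rightarrow> 'e \<Rightarrow> real"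
    and J :: "'e \<Rightarrow> 'e" and dJ :: "'e \<Rightarrow> 'e \<Rightarrow> 'e" and \<Gamma> :: "'e \<Rightarrow> 'e \<Rightarrow> 'e"
    and d\<Omega> :: "'e \<Rightarrow> 'e \<Rightarrow> 'e \<Rightarrow> real"
  assumes G: "bilinear G" "\<And>u v. G u v = G v u"
    and J: "\<And>u. J (J u) = - u" "\<And>u v. G (J u) (J v) = G u v"
    and dG: "\<And>x u v. dG x u v = dG x v u" "\<And>x u v. dG x u (- v) = - dG x u v"
    and dJ: "\<And>x u. dJ x (J u) = - J (dJ x u)"
    and dGJ: "\<And>x u v. dG x (J u) (J v) + G (dJ x u) (J v) + G (J u) (dJ x v) = dG x u v"
    and \<Gamma>: "\<And>u v w. 2 * G (\<Gamma> u v) w = dG u v w + dG v u w - dG w u v"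
    and d\<Omega>: "\<And>x y z. d\<Omega> x y z = dG x y (J z) + G y (dJ x z) + dG y z (J x) + G z (dJ y x)
                  + dG z x (J y) + G x (dJ z y)"
    and N: "dJ (J y) z - dJ (J z) y + J (dJ z y) - J (dJ y z) = 0"
  shows "2 * G (dJ x y + \<Gamma> x (J y) - J (\<Gamma> x y)) z = d\<Omega> x (J y) (J z) - d\<Omega> x y z"
proof -
  have lin: "G (u + v) w = G u w + G v w" "G (u - v) w = G u w - G v w" "G (- u) w = - G u w"
      "G w (u + v) = G w u + G w v" "G w (u - v) = G w u - G w v" "G w (- u) = - G w u" for u v w
    by (simp_all add: bilinear_ladd[OF G(1)] bilinear_radd[OF G(1)] bilinear_lsub[OF G(1)]
        bilinear_rsub[OF G(1)] bilinear_lneg[OF G(1)] bilinear_rneg[OF G(1)])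
  have skew: "G (J u) v = - G u (J v)" for u v
    using J(2)[of u "J v"] by (simp add: J(1) lin)
  have dGneg: "dG x (- u) v = - dG x u v" for x u v
    using dG by metis
  have lcomm: "G (J u) (J v) = G v u" for u v
    using J(2) G(2) by metis
  have compat: "dG x (J u) v + dG x u (J v) = - G (dJ x u) v - G u (dJ x v)" for x u v
    using dGJ[of x u "J v"] by (simp add: J dJ dG(2) lin)
  have nij: "G (dJ (J y) z) (J x) - G (dJ (J z) y) (J x) + G (dJ z y) x - G (dJ y z) x = 0"
    using arg_cong[OF N, of "\<lambda>n. G n (J x)"] bilinear_lzero[OF G(1)] by (simp add: lin J(2))
  have "G (J y) (dJ x (J z)) = - G y (dJ x z)" "G x (dJ (J z) (J y)) = G (dJ (J z) y) (J x)"
    by (simp_all add: dJ lin J skew G(2)[of x])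
  moreover have "dG (J y) (J z) (J x) + G (J z) (dJ (J y) x) = dG (J y) z x - G (dJ (J y) z) (J x)"
    using dGJ[of "J y" z x] by simp
  ultimately have rhs1: "d\<Omega> x (J y) (J z) = - dG x (J y) z - G y (dJ x z) + dG (J y) z x
      - G (dJ (J y) z) (J x) - dG (J z) x y + G (dJ (J z) y) (J x)"
    using d\<Omega>[of x "J y" "J z"] by (simp add: J(1) dG(2))
  have lhs: "2 * G (dJ x y + \<Gamma> x (J y) - J (\<Gamma> x y)) z = 2 * G (dJ x y) z
      + (dG x (J y) z + dG (J y) x z - dG z x (J y)) + (dG x y (J z) + dG y x (J z) - dG (J z) x y)"
    using \<Gamma>[of x "J y" z] \<Gamma>[of x y "J z"] by (simp add: lin skew)
  show ?thesis
    unfolding lhs rhs1 d\<Omega>[of x y z]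
    \<comment> \<open>After \<open>nij\<close>, only terms differentiated along \<open>x\<close> or \<open>y\<close> are left over; \<open>compat\<close> in these
      two directions cancels them.\<close>
    using nij compat[of x y z] compat[of y x z] dG(1)[of y z "J x"] dG(1)[of y "J x" z]
      dG(1)[of "J y" z x] G(2)[of z "dJ y x"] G(2)[of x "dJ z y"] G(2)[of x "dJ y z"]
      G(2)[of y "dJ x z"]
    by linarith
qed

definition deriv_endo ::
    "('m, 'e::euclidean_space) chart set \<Rightarrow> ('m \<Rightarrow> 'e \<Rightarrow> 'e) \<Rightarrow> 'm \<Rightarrow> 'e \<Rightarrow> 'e \<Rightarrow> 'e" where
  "deriv_endo A J p x u =
     frechet_derivative (\<lambda>y. endo_rep A (chart_at A p) J y u) (at (coord_at A p)) x"

definition nabla_endo ::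
    "('m, 'e::euclidean_space) chart set \<Rightarrow> ('m \<Rightarrow> 'e \<Rightarrow> 'e \<Rightarrow> real) \<Rightarrow> ('m \<Rightarrow> 'e \<Rightarrow> 'e)
     \<Rightarrow> 'm \<Rightarrow> 'e \<Rightarrow> 'e \<Rightarrow> 'e" where
  "nabla_endo A g J p x u =
     deriv_endo A J p x u + christoffel A g p x (J p u) - J p (christoffel A g p x u)"

locale hermitian_mfd =
  fixes A :: "('m::{t2_space,second_countable_topology}, 'e::euclidean_space) chart set"
    and g :: "'m \<Rightarrow> 'e \<Rightarrow> 'e \<Rightarrow> real" and J :: "'m \<Rightarrow> 'e \<Rightarrow> 'e"
  assumes hermitian: "hermitian_manifold A g J"
begin

lemma riemannian: "riemannian_manifold A g"
  using hermitian by (simp add: hermitian_manifold_def)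

sublocale smooth_mfd A
  by standard (use riemannian in \<open>simp add: riemannian_manifold_def\<close>)

lemma bilinear_g: "bilinear (g p)" and g_sym: "g p u v = g p v u"
  and g_pos: "u \<noteq> 0 \<Longrightarrow> g p u u > 0"
  using riemannian by (simp_all add: riemannian_manifold_def)

lemma g_eq_0_iff: "g p u u = 0 \<longleftrightarrow> u = 0"
  using g_pos[of u p] bilinear_lzero[OF bilinear_g] by force

lemmas g_lin =
  bilinear_ladd[OF bilinear_g] bilinear_radd[OF bilinear_g] bilinear_lsub[OF bilinear_g]
  bilinear_rsub[OF bilinear_g] bilinear_lneg[OF bilinear_g] bilinear_rneg[OF bilinear_g]
  bilinear_lmul[OF bilinear_g] bilinear_rmul[OF bilinear_g]
  bilinear_lzero[OF bilinear_g] bilinear_rzero[OF bilinear_g]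

lemma linear_J: "linear (J p)"
  using hermitian by (simp add: hermitian_manifold_def smooth_endo_def)

lemma J_J [simp]: "J p (J p u) = - u" and g_J_J [simp]: "g p (J p u) (J p v) = g p u v"
  using hermitian by (simp_all add: hermitian_manifold_def)

lemma g_J_skew: "g p (J p u) v = - g p u (J p v)"
  using g_J_J[of p u "J p v"] by (simp add: g_lin del: g_J_J)

lemma nijenhuis_eq_0:
  "open S \<Longrightarrow> smooth_vfield_on A S X \<Longrightarrow> smooth_vfield_on A S Y \<Longrightarrow> p \<in> S \<Longrightarrow> nijenhuis A J X Y p = 0"
  using hermitian unfolding hermitian_manifold_def by blast

context
  fixes p :: 'm
begin

abbreviation "coord_range \<equiv> snd (chart_at A p) ` fst (chart_at A p)"
abbreviation "G \<equiv> form2_rep A (chart_at A p) g"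
abbreviation "K \<equiv> endo_rep A (chart_at A p) J"

lemma open_coord_range: "open coord_range"
  using open_chart_image[OF chart_at(1) open_chart_domain] chart_at by blast

lemma coord_in_range: "coord_at A p \<in> coord_range"
  using chart_at by blast

lemma chart_inv_coord_range: "y \<in> coord_range \<Longrightarrow> chart_inv (chart_at A p) y \<in> fst (chart_at A p)"
  using chart_at by auto

lemma G_coord: "G (coord_at A p) u v = g p u v"
  by (simp add: form2_rep_def chart_at)

lemma K_coord: "K (coord_at A p) u = J p u"
  by (simp add: endo_rep_def chart_at)

lemma bilinear_G:
  assumes "y \<in> coord_range"
  shows "bilinear (G y)"
proof -
  interpret linear "tan_from A (chart_at A p) (chart_inv (chart_at A p) y)"
    by (rule linear_tan_from[OF chart_at(1) chart_inv_coord_range[OF assms]])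
  show ?thesis
    unfolding bilinear_def form2_rep_def Let_def by (auto intro!: linearI simp: add scale g_lin)
qed

lemma linear_K:
  assumes "y \<in> coord_range"
  shows "linear (K y)"
proof -
  interpret dn: linear "tan_from A (chart_at A p) (chart_inv (chart_at A p) y)"
    by (rule linear_tan_from[OF chart_at(1) chart_inv_coord_range[OF assms]])
  interpret up: linear "tan_to A (chart_at A p) (chart_inv (chart_at A p) y)"
    by (rule linear_tan_to[OF chart_at(1) chart_inv_coord_range[OF assms]])
  interpret J: linear "J (chart_inv (chart_at A p) y)"
    by (rule linear_J)
  show ?thesis
    unfolding endo_rep_def Let_def
    by (rule linearI) (simp_all add: dn.add dn.scale up.add up.scale J.add J.scale)
qed

lemma K_K: "y \<in> coord_range \<Longrightarrow> K y (K y u) = - u"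
  using linear_tan_to[OF chart_at(1) chart_inv_coord_range]
  by (simp add: endo_rep_def Let_def chart_at chart_inv_coord_range linear_neg)

lemma G_K_K: "y \<in> coord_range \<Longrightarrow> G y (K y u) (K y v) = G y u v"
  by (simp add: form2_rep_def endo_rep_def Let_def chart_at chart_inv_coord_range)

lemma differentiable_G: "(\<lambda>y. G y u v) differentiable (at (coord_at A p))"
  using riemannian chart_at(1) coord_in_range
  by (intro smooth_on_imp_differentiable[of coord_range]) (simp_all add: riemannian_manifold_def)

lemma differentiable_K: "(\<lambda>y. K y u) differentiable (at (coord_at A p))"
  using hermitian chart_at(1) coord_in_range
  by (intro smooth_on_imp_differentiable[of coord_range])
     (simp_all add: hermitian_manifold_def smooth_endo_def)

lemma has_derivative_G:
  assumes "(a has_derivative a') (at (coord_at A p))" "(b has_derivative b') (at (coord_at A p))"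
  shows "((\<lambda>y. G y (a y) (b y)) has_derivative
           (\<lambda>x. deriv_form2 A g p x (a (coord_at A p)) (b (coord_at A p))
                + g p (a' x) (b (coord_at A p)) + g p (a (coord_at A p)) (b' x)))
         (at (coord_at A p))"
  using has_derivative_bilinear_family[OF open_coord_range coord_in_range bilinear_G differentiable_G assms]
  by (simp add: deriv_form2_def G_coord)

lemma has_derivative_K:
  assumes "(a has_derivative a') (at (coord_at A p))"
  shows "((\<lambda>y. K y (a y)) has_derivative
           (\<lambda>x. deriv_endo A J p x (a (coord_at A p)) + J p (a' x))) (at (coord_at A p))"
  using has_derivative_linear_family[OF open_coord_range coord_in_range linear_K differentiable_K assms]
  by (simp add: deriv_endo_def K_coord)

lemmas has_derivative_K_const =
  has_derivative_K[OF has_derivative_const, simplified linear_0[OF linear_J] add_0_right]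

lemma deriv_form2_g_sym: "deriv_form2 A g p x u v = deriv_form2 A g p x v u"
  by (simp add: deriv_form2_def form2_rep_def g_sym)

lemma linear_deriv_form2_g: "linear (deriv_form2 A g p x u)"
  unfolding deriv_form2_def
  using bilinear_G differentiable_G
  by (intro linear_frechet_derivative_family[OF open_coord_range coord_in_range, where L = "\<lambda>y. G y u"])
     (auto simp: bilinear_def)

lemma linear_deriv_form2_direction: "linear (\<lambda>x. deriv_form2 A g p x u v)"
  unfolding deriv_form2_def
  using differentiable_G[of u v] has_derivative_linear by (auto simp: frechet_derivative_works)

lemma deriv_endo_J: "deriv_endo A J p x (J p u) = - J p (deriv_endo A J p x u)"
proof -
  have "((\<lambda>y. K y (K y u)) has_derivative
      (\<lambda>x. deriv_endo A J p x (J p u) + J p (deriv_endo A J p x u))) (at (coord_at A p))"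
    using has_derivative_K[OF has_derivative_K_const[of u]] by (simp add: K_coord)
  moreover have "((\<lambda>y. K y (K y u)) has_derivative (\<lambda>x. 0)) (at (coord_at A p))"
    by (rule has_derivative_transform_within_open[OF has_derivative_const open_coord_range coord_in_range])
       (simp add: K_K)
  ultimately have "(\<lambda>x. deriv_endo A J p x (J p u) + J p (deriv_endo A J p x u)) = (\<lambda>x. 0)"
    by (rule has_derivative_unique)
  from fun_cong[OF this, of x] show ?thesis
    by (simp add: add_eq_0_iff)
qed

lemma deriv_form2_g_J_J:
  "deriv_form2 A g p x (J p u) (J p v) + g p (deriv_endo A J p x u) (J p v)
    + g p (J p u) (deriv_endo A J p x v) = deriv_form2 A g p x u v"
proof -
  have "((\<lambda>y. G y (K y u) (K y v)) has_derivative
      (\<lambda>x. deriv_form2 A g p x (J p u) (J p v) + g p (deriv_endo A J p x u) (J p v)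
        + g p (J p u) (deriv_endo A J p x v))) (at (coord_at A p))"
    using has_derivative_G[OF has_derivative_K_const[of u] has_derivative_K_const[of v]]
    by (simp add: K_coord)
  moreover have "((\<lambda>y. G y u v) has_derivative (\<lambda>x. deriv_form2 A g p x u v)) (at (coord_at A p))"
    using has_derivative_G[OF has_derivative_const has_derivative_const] by (simp add: g_lin)
  then have "((\<lambda>y. G y (K y u) (K y v)) has_derivative (\<lambda>x. deriv_form2 A g p x u v))
      (at (coord_at A p))"
    by (rule has_derivative_transform_within_open[OF _ open_coord_range coord_in_range]) (simp add: G_K_K)
  ultimately have "(\<lambda>x. deriv_form2 A g p x (J p u) (J p v) + g p (deriv_endo A J p x u) (J p v)
        + g p (J p u) (deriv_endo A J p x v)) = (\<lambda>x. deriv_form2 A g p x u v)"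
    by (rule has_derivative_unique)
  from fun_cong[OF this, of x] show ?thesis
    by simp
qed

lemma deriv_fundamental_form:
  "deriv_form2 A (fundamental_form g J) p x u v
    = deriv_form2 A g p x u (J p v) + g p u (deriv_endo A J p x v)"
proof -
  have "((\<lambda>y. G y u (K y v)) has_derivative
      (\<lambda>x. deriv_form2 A g p x u (J p v) + g p u (deriv_endo A J p x v))) (at (coord_at A p))"
    using has_derivative_G[OF has_derivative_const has_derivative_K_const[of v]]
    by (simp add: K_coord g_lin)
  then have "((\<lambda>y. form2_rep A (chart_at A p) (fundamental_form g J) y u v) has_derivative
      (\<lambda>x. deriv_form2 A g p x u (J p v) + g p u (deriv_endo A J p x v))) (at (coord_at A p))"
    by (rule has_derivative_transform_within_open[OF _ open_coord_range coord_in_range])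
       (simp add: form2_rep_def endo_rep_def Let_def chart_at chart_inv_coord_range fundamental_form_def)
  from fun_cong[OF frechet_derivative_at[OF this], of x] show ?thesis
    by (simp add: deriv_form2_def)
qed

text \<open>A positive definite form represents every linear functional, so the defining equation of the
  Christoffel symbols has exactly one solution.\<close>

lemma g_represents_functional:
  assumes "linear F"
  shows "\<exists>!z. \<forall>w. g p z w = F w"
proof -
  let ?\<phi> = "\<lambda>z. \<Sum>i\<in>Basis. g p z i *\<^sub>R i"
  have \<phi>: "?\<phi> z \<bullet> w = g p z w" for z w
  proof -
    interpret linear "g p z"
      using bilinear_g by (simp add: bilinear_def)
    have "g p z w = g p z (\<Sum>i\<in>Basis. (w \<bullet> i) *\<^sub>R i)"
      by (simp add: euclidean_representation)
    also have "\<dots> = ?\<phi> z \<bullet> w"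
      by (simp add: sum scale inner_sum_right inner_commute[of _ w] mult.commute)
    finally show ?thesis
      by simp
  qed
  have lin: "linear ?\<phi>"
    by (rule linearI) (simp_all add: g_lin sum.distrib scaleR_add_left scaleR_sum_right)
  have "z = 0" if "?\<phi> z = 0" for z
    using \<phi>[of z z] g_eq_0_iff[of p z] by (simp add: that)
  then have "inj ?\<phi>"
    by (simp add: linear_injective_0[OF lin])
  then have "surj ?\<phi>"
    by (rule linear_injective_imp_surjective[OF lin]) (rule refl)
  from surjD[OF this, of "\<Sum>i\<in>Basis. F i *\<^sub>R i"]
  obtain z where z: "?\<phi> z = (\<Sum>i\<in>Basis. F i *\<^sub>R i)"
    by (elim exE) (rule that, erule sym)
  interpret F: linear F by (rule assms)
  have "g p z w = F w" for w
  proof -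
    have "F w = F (\<Sum>i\<in>Basis. (w \<bullet> i) *\<^sub>R i)"
      by (simp add: euclidean_representation)
    also have "\<dots> = (\<Sum>i\<in>Basis. F i *\<^sub>R i) \<bullet> w"
      by (simp add: F.sum F.scale inner_sum_right inner_commute[of _ w] mult.commute)
    also have "\<dots> = g p z w"
      using \<phi>[of z w] by (simp only: z)
    finally show ?thesis
      by (rule sym)
  qed
  moreover have "z' = z''" if "\<forall>w. g p z' w = F w" "\<forall>w. g p z'' w = F w" for z' z''
    using that g_eq_0_iff[of p "z' - z''"] by (simp add: g_lin)
  ultimately show ?thesis
    by blast
qed

lemma g_christoffel:
  "2 * g p (christoffel A g p u v) w
    = deriv_form2 A g p u v w + deriv_form2 A g p v u w - deriv_form2 A g p w u v"
proof -
  have "linear (\<lambda>w. (deriv_form2 A g p u v w + deriv_form2 A g p v u w - deriv_form2 A g p w u v) / 2)"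
    by (rule linearI)
       (simp_all add: linear_add[OF linear_deriv_form2_g] linear_scale[OF linear_deriv_form2_g]
         linear_add[OF linear_deriv_form2_direction] linear_scale[OF linear_deriv_form2_direction]
         field_simps)
  from theI'[OF g_represents_functional[OF this]]
  have "g p (christoffel A g p u v) w
    = (deriv_form2 A g p u v w + deriv_form2 A g p v u w - deriv_form2 A g p w u v) / 2"
    unfolding christoffel_def by blast
  then show ?thesis
    by simp
qed

text \<open>In a chart the coordinate fields commute, so that only derivatives of the components of
  \<open>J\<close> remain in the Nijenhuis tensor.\<close>

lemma deriv_endo_integrable:
  "deriv_endo A J p (J p u) v - deriv_endo A J p (J p v) u
    + J p (deriv_endo A J p v u) - J p (deriv_endo A J p u v) = 0"
proof -
  let ?c = "chart_at A p"
  let ?X = "\<lambda>w q. tan_from A ?c q w"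
  have const: "frechet_derivative (vfield_rep A ?c (?X w)) (at (coord_at A p)) x = 0" for w x
  proof -
    have "(vfield_rep A ?c (?X w) has_derivative (\<lambda>x. 0)) (at (coord_at A p))"
      by (rule has_derivative_transform_within_open[OF has_derivative_const open_coord_range coord_in_range])
         (simp add: vfield_rep_def Let_def chart_at chart_inv_coord_range)
    from fun_cong[OF frechet_derivative_at[OF this], of x] show ?thesis
      by simp
  qed
  have "vfield_rep A ?c (\<lambda>q. J q (?X w q)) = (\<lambda>y. K y w)" for w
    by (simp add: vfield_rep_def endo_rep_def fun_eq_iff)
  then have JX: "frechet_derivative (vfield_rep A ?c (\<lambda>q. J q (?X w q))) (at (coord_at A p)) x
      = deriv_endo A J p x w" for w x
    by (simp add: deriv_endo_def)
  have "nijenhuis A J (?X u) (?X v) p = 0"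
    using chart_at open_chart_domain smooth_vfield_const_components
    by (intro nijenhuis_eq_0[where S = "fst ?c"]) auto
  then show ?thesis
    using linear_J[of p] by (simp add: nijenhuis_def lie_bracket_def const JX linear_neg)
qed

text \<open>Integrability enters only through this formula. It passes from \<open>d\<Omega>\<close>, which the locally
  conformal Kaehler condition prescribes, to \<open>\<nabla>J\<close>, which governs second fundamental forms.\<close>

lemma g_nabla_endo:
  "2 * g p (nabla_endo A g J p x y) z
    = ext_d2 A (fundamental_form g J) p x (J p y) (J p z) - ext_d2 A (fundamental_form g J) p x y z"
  unfolding nabla_endo_def
  by (rule hermitian_covariant_derivative_formula[where G = "g p" and J = "J p"
        and dG = "deriv_form2 A g p" and dJ = "deriv_endo A J p" and \<Gamma> = "christoffel A g p"])
     (rule bilinear_g g_sym J_J g_J_J deriv_form2_g_sym linear_neg[OF linear_deriv_form2_g]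
        deriv_endo_J deriv_form2_g_J_J g_christoffel deriv_endo_integrable
      | simp add: ext_d2_def deriv_fundamental_form)+

end

end


section \<open>Lagrangian foliations of locally conformal Kaehler manifolds\<close>

text \<open>For \<open>h = J u\<close> and \<open>v = w\<close> orthogonal to \<open>u\<close> the symmetry \<open>sym\<close> reads
  \<open>g(v, v) g(h, h) = 0\<close>. Such a \<open>v \<noteq> 0\<close> fails to exist only
  if the Lagrangian subspace is a line, in a tangent space of dimension two.\<close>

lemma (in hermitian_mfd) symmetric_umbilical_form_eq_0:
  fixes D :: "'e set"
  assumes dim: "DIM('e) > 2" and D: "subspace D"
    and span: "\<And>x. \<exists>a\<in>J p ` D. \<exists>b\<in>D. x = a + b"
    and sym: "\<And>u v w. u \<in> D \<Longrightarrow> v \<in> D \<Longrightarrow> w \<in> D \<Longrightarrow>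
               g p v w * g p h (J p u) = g p v u * g p h (J p w)"
    and h: "h \<in> J p ` D"
  shows "h = 0"
proof (rule ccontr)
  assume "h \<noteq> 0"
  obtain u where u: "u \<in> D" "h = J p u"
    using h by blast
  then have pos: "g p u u > 0"
    using \<open>h \<noteq> 0\<close> linear_0[OF linear_J] g_pos by metis
  have orth: "v = 0" if "v \<in> D" "g p v u = 0" for v
    using sym[OF u(1) that(1,1)] that pos by (auto simp: u(2) g_eq_0_iff g_lin)
  \<comment> \<open>A vector of \<open>D\<close> minus its projection to \<open>u\<close> is orthogonal to \<open>u\<close>, hence zero.\<close>
  have line: "v \<in> span {u}" if "v \<in> D" for v
  proof -
    let ?r = "g p v u / g p u u"
    have "v - ?r *\<^sub>R u = 0"
    proof (rule orth)
      show "v - ?r *\<^sub>R u \<in> D"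
        using D u(1) that by (intro subspace_diff subspace_scale)
      show "g p (v - ?r *\<^sub>R u) u = 0"
        using pos by (simp add: g_lin)
    qed
    then show ?thesis
      by (metis right_minus_eq span_base span_scale singletonI)
  qed
  have "x \<in> span {J p u, u}" for x
  proof -
    obtain a b where "a \<in> D" "b \<in> D" "x = J p a + b"
      using span[of x] by blast
    moreover from line[OF this(1)] line[OF this(2)] obtain r s where "a = r *\<^sub>R u" "b = s *\<^sub>R u"
      by (auto simp: span_singleton)
    ultimately have "x = r *\<^sub>R J p u + s *\<^sub>R u"
      by (simp add: linear_scale[OF linear_J])
    then show ?thesis
      by (simp add: span_add span_scale span_base)
  qed
  then have "dim (UNIV :: 'e set) \<le> card {J p u, u}"
    by (intro dim_le_card) auto
  also have "\<dots> \<le> 2"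
    by (simp add: card_insert_if)
  finally show False
    using dim by simp
qed

locale lck_mfd =
  fixes A :: "('m::{t2_space,second_countable_topology}, 'e::euclidean_space) chart set"
    and g :: "'m \<Rightarrow> 'e \<Rightarrow> 'e \<Rightarrow> real" and J :: "'m \<Rightarrow> 'e \<Rightarrow> 'e" and \<omega> :: "'m \<Rightarrow> 'e \<Rightarrow> real"
  assumes lck: "lck_manifold A g J \<omega>"
begin

sublocale hermitian_mfd A g J
  by standard (use lck in \<open>simp add: lck_manifold_def\<close>)

lemma ext_d2_fundamental_form:
  "ext_d2 A (fundamental_form g J) p u v w = wedge12 \<omega> (fundamental_form g J) p u v w"
  using lck by (simp add: lck_manifold_def)

text \<open>Every term of \<open>\<omega> \<and> \<Omega>\<close> vanishes on \<open>(x, y, z)\<close> and on \<open>(x, J y, J z)\<close>, because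
  \<open>\<Omega>\<close> is zero on \<open>D\<close> and on \<open>J D\<close> and \<open>\<omega>\<close> is zero on \<open>J D\<close>.\<close>

lemma g_nabla_endo_isotropic:
  assumes iso: "\<And>u v. u \<in> D \<Longrightarrow> v \<in> D \<Longrightarrow> g p u (J p v) = 0"
    and lee: "\<And>v. v \<in> D \<Longrightarrow> \<omega> p (J p v) = 0"
    and "x \<in> D" "y \<in> D" "z \<in> D"
  shows "g p (nabla_endo A g J p x y) z = 0"
  using g_nabla_endo[of p x y z] assms(3-5) iso g_J_skew[of p y z]
  by (simp add: ext_d2_fundamental_form wedge12_def fundamental_form_def lee g_lin)

text \<open>Symmetry of the second fundamental form of a Lagrangian foliation: differentiating
  \<open>g(W, J U) = 0\<close> along \<open>V\<close> gives
  \<open>g(\<nabla>\<^sub>V W, J U) - g(\<nabla>\<^sub>V U, J W) = - g(W, (\<nabla>\<^sub>V J) U)\<close>, and the right-hand side vanishes.\<close>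

lemma isotropic_second_fundamental_form_sym:
  assumes "open T" "p \<in> T"
    and iso: "\<And>q u v. q \<in> T \<Longrightarrow> u \<in> D q \<Longrightarrow> v \<in> D q \<Longrightarrow> g q u (J q v) = 0"
    and lee: "\<And>v. v \<in> D p \<Longrightarrow> \<omega> p (J p v) = 0"
    and V: "section_on A D T V" and W: "section_on A D T W" and U: "section_on A D T U"
  shows "g p (nabla A g V W p) (J p (U p)) = g p (nabla A g V U p) (J p (W p))"
proof -
  let ?c = "chart_at A p" and ?\<Gamma> = "christoffel A g p"
  define dW dU where
    "dW = frechet_derivative (vfield_rep A ?c W) (at (coord_at A p))" and
    "dU = frechet_derivative (vfield_rep A ?c U) (at (coord_at A p))"
  have dW: "(vfield_rep A ?c W has_derivative dW) (at (coord_at A p))"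
    and dU: "(vfield_rep A ?c U has_derivative dU) (at (coord_at A p))"
    using W U vfield_rep_has_derivative assms(2) by (auto simp: section_on_def dW_def dU_def)
  have "((\<lambda>y. form2_rep A ?c g y (vfield_rep A ?c W y) (endo_rep A ?c J y (vfield_rep A ?c U y)))
      has_derivative (\<lambda>x. deriv_form2 A g p x (W p) (J p (U p)) + g p (dW x) (J p (U p))
        + g p (W p) (deriv_endo A J p x (U p) + J p (dU x)))) (at (coord_at A p))"
    using has_derivative_G[OF dW has_derivative_K[OF dU]] by (simp add: K_coord)
  moreover have "((\<lambda>y. form2_rep A ?c g y (vfield_rep A ?c W y)
      (endo_rep A ?c J y (vfield_rep A ?c U y))) has_derivative (\<lambda>x. 0)) (at (coord_at A p))"
  proof (rule has_derivative_transform_within_open[OF has_derivative_const])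
    show "open (snd ?c ` (fst ?c \<inter> T))"
      by (intro open_overlap_image chart_at assms(1))
    show "coord_at A p \<in> snd ?c ` (fst ?c \<inter> T)"
      using chart_at assms(2) by blast
    show "0 = form2_rep A ?c g y (vfield_rep A ?c W y) (endo_rep A ?c J y (vfield_rep A ?c U y))"
      if "y \<in> snd ?c ` (fst ?c \<inter> T)" for y
      using that W U
      by (auto simp: form2_rep_def endo_rep_def vfield_rep_def Let_def chart_at section_on_def iso)
  qed
  ultimately have "(\<lambda>x. deriv_form2 A g p x (W p) (J p (U p)) + g p (dW x) (J p (U p))
        + g p (W p) (deriv_endo A J p x (U p) + J p (dU x))) = (\<lambda>x. 0)"
    by (rule has_derivative_unique)
  from fun_cong[OF this, of "V p"]
  have "deriv_form2 A g p (V p) (W p) (J p (U p)) + g p (dW (V p)) (J p (U p))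
      + g p (W p) (deriv_endo A J p (V p) (U p)) - g p (dU (V p)) (J p (W p)) = 0"
    using g_J_skew[of p "W p" "dU (V p)"] g_sym[of p "J p (W p)"] by (simp add: g_lin)
  \<comment> \<open>The connection is metric.\<close>
  moreover have "deriv_form2 A g p (V p) (W p) (J p (U p))
      = g p (?\<Gamma> (V p) (W p)) (J p (U p)) + g p (W p) (?\<Gamma> (V p) (J p (U p)))"
    using g_christoffel[of p "V p" "W p" "J p (U p)"] g_christoffel[of p "V p" "J p (U p)" "W p"]
      deriv_form2_g_sym[of p "V p" "W p"] deriv_form2_g_sym[of p _ "V p"]
      g_sym[of p "W p" "?\<Gamma> (V p) (J p (U p))"]
    by simp
  moreover have "g p (W p) (deriv_endo A J p (V p) (U p)) + g p (W p) (?\<Gamma> (V p) (J p (U p)))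
      + g p (?\<Gamma> (V p) (U p)) (J p (W p)) = 0"
  proof -
    have "g p (nabla_endo A g J p (V p) (U p)) (W p) = 0"
      using V W U assms(2) iso lee
      by (intro g_nabla_endo_isotropic[of "D p"]) (auto simp: section_on_def)
    then show ?thesis
      using g_J_skew[of p "?\<Gamma> (V p) (U p)" "W p"]
      by (simp add: nabla_endo_def g_lin g_sym[of p "W p"])
  qed
  ultimately show ?thesis
    by (simp add: nabla_def g_lin flip: dW_def dU_def)
qed

text \<open>Umbilicity turns the symmetric second fundamental form into \<open>g(V, W) g(h, J U)\<close>. The fields
  that realise arbitrary vectors of \<open>D p\<close> come from the product chart, and so does the
  decomposition of the tangent space into \<open>J (D p)\<close> and \<open>D p\<close>.\<close>

lemma lagrangian_umbilical_imp_totally_geodesic: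
  assumes dim: "DIM('e) > 2"
    and lag: "\<And>q. J q ` D q = orth_distr g D q"
    and lee: "\<And>q v. v \<in> D q \<Longrightarrow> \<omega> q (J q v) = 0"
    and prod: "product_chart A (orth_distr g D) D c"
    and umb: "totally_umbilical_on A g D (fst c)"
  shows "totally_geodesic_on A g D (fst c)"
proof -
  obtain E\<^sub>1 E\<^sub>2 where c: "c \<in> A" and E: "subspace E\<^sub>2" "{a + b |a b. a \<in> E\<^sub>1 \<and> b \<in> E\<^sub>2} = UNIV"
    and D: "\<And>q. q \<in> fst c \<Longrightarrow> orth_distr g D q = {v. tan_to A c q v \<in> E\<^sub>1}"
      "\<And>q. q \<in> fst c \<Longrightarrow> D q = {v. tan_to A c q v \<in> E\<^sub>2}"
    using prod unfolding product_chart_def by (elim conjE exE) (rule that; simp)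
  have iso: "g q u (J q v) = 0" if "u \<in> D q" "v \<in> D q" for q u v
  proof -
    have "J q v \<in> orth_distr g D q"
      using that lag by blast
    then show ?thesis
      using that g_sym by (simp add: orth_distr_def)
  qed
  have "nabla A g V W p \<in> D p"
    if T: "open T" "T \<subseteq> fst c" "p \<in> T" and VW: "section_on A D T V" "section_on A D T W" for T V W p
  proof -
    have p: "p \<in> fst c"
      using T by blast
    interpret up: linear "tan_to A c p"
      by (rule linear_tan_to[OF c p])
    interpret dn: linear "tan_from A c p"
      by (rule linear_tan_from[OF c p])
    obtain h where h: "h \<in> orth_distr g D p" and
      all: "\<forall>T V W. open T \<and> p \<in> T \<and> T \<subseteq> fst c \<and> section_on A D T V \<and> section_on A D T W \<longrightarrow>
        nabla A g V W p - g p (V p) (W p) *\<^sub>R h \<in> D p"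
      by (rule bexE[OF bspec[OF umb[unfolded totally_umbilical_on_def] p]])
    have umb_h: "nabla A g V W p - g p (V p) (W p) *\<^sub>R h \<in> D p"
      if "open T" "p \<in> T" "T \<subseteq> fst c" "section_on A D T V" "section_on A D T W" for T V W
      using all that by simp
    have "h = 0"
    proof (rule symmetric_umbilical_form_eq_0[OF dim])
      show "subspace (D p)"
        using E(1) by (auto simp: D(2)[OF p] subspace_def up.add up.scale)
      show "\<exists>a\<in>J p ` D p. \<exists>b\<in>D p. x = a + b" for x
      proof -
        obtain a b where ab: "a \<in> E\<^sub>1" "b \<in> E\<^sub>2" "tan_to A c p x = a + b"
          using E(2) by blast
        then have "x = tan_from A c p a + tan_from A c p b"
          using tan_from_tan_to_self[OF c p, of x] by (simp add: dn.add)
        moreover have "tan_from A c p a \<in> J p ` D p" "tan_from A c p b \<in> D p"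
          unfolding lag using ab c p by (simp_all add: D)
        ultimately show ?thesis
          by blast
      qed
      show "h \<in> J p ` D p"
        using h lag by simp
      show "g p v w * g p h (J p u) = g p v u * g p h (J p w)"
        if uvw: "u \<in> D p" "v \<in> D p" "w \<in> D p" for u v w
      proof -
        obtain V where V: "section_on A D (fst c) V" "V p = v"
          by (rule section_through_vector[OF c p D(2) uvw(2)])
        obtain W where W: "section_on A D (fst c) W" "W p = w"
          by (rule section_through_vector[OF c p D(2) uvw(3)])
        obtain U where U: "section_on A D (fst c) U" "U p = u"
          by (rule section_through_vector[OF c p D(2) uvw(1)])
        have ort: "g p (nabla A g V X p) (J p y) = g p v (X p) * g p h (J p y)"
          if "section_on A D (fst c) X" "y \<in> D p" for X y
          using iso[OF umb_h[OF open_chart_domain[OF c] p order_refl V(1) that(1)] that(2)]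
          by (simp add: g_lin V(2))
        show ?thesis
          using isotropic_second_fundamental_form_sym
              [OF open_chart_domain[OF c] p iso lee V(1) W(1) U(1)]
            ort[OF W(1) uvw(1)] ort[OF U(1) uvw(3)] by (simp add: W(2) U(2))
      qed
    qed
    then show ?thesis
      using umb_h[OF T(1,3,2) VW] by simp
  qed
  then show ?thesis
    unfolding totally_geodesic_on_def by blast
qed

end

theorem theorem5p5:
  fixes A :: "('m::{t2_space,second_countable_topology}, 'e::euclidean_space) chart set"
    and g :: "'m \<Rightarrow> 'e \<Rightarrow> 'e \<Rightarrow> real"
    and J :: "'m \<Rightarrow> 'e \<Rightarrow> 'e"
    and \<omega> :: "'m \<Rightarrow> 'e \<Rightarrow> real"
    and B\<^sub>1 :: "'m \<Rightarrow> 'e"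
    and A' :: "('b::{t2_space,second_countable_topology}, 'f::euclidean_space) chart set"
    and g' :: "'b \<Rightarrow> 'f \<Rightarrow> 'f \<Rightarrow> real"
  assumes "lck_manifold A g J \<omega>"
    and "DIM('e) \<ge> 4"
    and "is_lee_vfield g \<omega> B\<^sub>1"
    and "riemannian_manifold A' g'"
  shows "\<not> (\<exists>\<pi> :: 'm \<Rightarrow> 'b.
    lagrangian_riemannian_submersion A g J A' g' \<pi> \<and>
    section_on A (vertical A A' \<pi>) UNIV B\<^sub>1 \<and>
    locally_proper_twisted_product A g (horizontal A g A' \<pi>) (vertical A A' \<pi>))"
proof
  assume "\<exists>\<pi> :: 'm \<Rightarrow> 'b.
    lagrangian_riemannian_submersion A g J A' g' \<pi> \<and>
    section_on A (vertical A A' \<pi>) UNIV B\<^sub>1 \<and>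
    locally_proper_twisted_product A g (horizontal A g A' \<pi>) (vertical A A' \<pi>)"
  then obtain \<pi> :: "'m \<Rightarrow> 'b" where lag: "\<And>p. J p ` vertical A A' \<pi> p = horizontal A g A' \<pi> p"
    and B\<^sub>1: "\<And>p. B\<^sub>1 p \<in> vertical A A' \<pi> p"
    and twisted: "locally_twisted_product A g (horizontal A g A' \<pi>) (vertical A A' \<pi>)"
    and proper: "\<not> locally_riemannian_product A g (horizontal A g A' \<pi>) (vertical A A' \<pi>)"
    by (auto simp: lagrangian_riemannian_submersion_def section_on_def
        locally_proper_twisted_product_def)
  interpret lck_mfd A g J \<omega>
    by standard (rule assms(1))
  have lee: "\<omega> q (J q v) = 0" if "v \<in> vertical A A' \<pi> q" for q v
  proof -
    have "J q v \<in> horizontal A g A' \<pi> q"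
      using that lag by blast
    then show ?thesis
      using B\<^sub>1 assms(3) unfolding orth_distr_def is_lee_vfield_def by fastforce
  qed
  have "locally_riemannian_product A g (horizontal A g A' \<pi>) (vertical A A' \<pi>)"
    unfolding locally_riemannian_product_def
  proof
    fix p
    obtain c where c: "p \<in> fst c" "product_chart A (horizontal A g A' \<pi>) (vertical A A' \<pi>) c"
        "perpendicular_on g (horizontal A g A' \<pi>) (vertical A A' \<pi>) (fst c)"
        "totally_geodesic_on A g (horizontal A g A' \<pi>) (fst c)"
        "totally_umbilical_on A g (vertical A A' \<pi>) (fst c)"
      using twisted unfolding locally_twisted_product_def by blast
    have "totally_geodesic_on A g (vertical A A' \<pi>) (fst c)"
      by (rule lagrangian_umbilical_imp_totally_geodesic[OF _ lag lee c(2,5)]) (use assms(2) in simp)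
    with c show "\<exists>c. p \<in> fst c \<and> product_chart A (horizontal A g A' \<pi>) (vertical A A' \<pi>) c \<and>
        perpendicular_on g (horizontal A g A' \<pi>) (vertical A A' \<pi>) (fst c) \<and>
        totally_geodesic_on A g (horizontal A g A' \<pi>) (fst c) \<and>
        totally_geodesic_on A g (vertical A A' \<pi>) (fst c)"
      by blast
  qed
  with proper show False
    by contradiction
qed

end
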